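(* If $\mathbb{E}[S_1^2]<+\infty$ and $\mathbb{E}[M_1^2]<+\infty$, then, with $$\mu:=\frac{\mathbb{E}[X_1]}{\mathbb{E}[S_1]},\qquad v:=\frac{\mathbb{E}[(X_1-\mu S_1)^2]}{\mathbb{E}[S_1]},$$ and provided that $v\neq 0$, for every $z\in\mathbb{R}$ $$\lim_{t\uparrow+\infty}\mathbb{P}\bigg[\frac{F_t-\mu t}{\sqrt{vt}}\le z\bigg]=\int_{-\infty}^z\frac{e^{-\frac12 x^2}}{\sqrt{2\pi}}\,dx .$$
   Context: Let $(\Omega,\mathcal{F},\mathbb{P})$ be a probability space with expectation $\mathbb{E}$. Let $S_1,S_2,\ldots$ (waiting times) be i.i.d. non-negative real random variables with $\mathbb{P}[S_1=0]<1$; put $T_0:=0$, $T_n:=S_1+\cdots+S_n$, and $N_t:=\sup\{n\ge 0:T_n\le t\}$ for $t\ge 0$ (almost surely finite for all $t$). Let $\{B_{1,t}\}_{t\ge 0},\{B_{2,t}\}_{t\ge 0},\ldots$ be i.i.d. $\mathbb{R}$-valued stochastic processes with measurable sample paths, independent of the waiting times. The process under resetting is $Z_t:=B_{N_t+1,\,t-T_{N_t}}$, $t\ge 0$. Let $f:\mathbb{R}\to\mathbb{R}$ be measurable and define the additive functional $$F_t:=\int_0^t f(Z_\tau)\,d\tau,$$ together with $$X_n:=\int_0^{S_n}f(B_{n,\tau})\,d\tau,\qquad M_n:=\int_0^{S_n}|f(B_{n,\tau})|\,d\tau .$$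
   Formalization: The processes B_n are assumed jointly measurable in time and outcome, not merely to have measurable sample paths; with measurable paths alone, i.i.d. processes (in finite-dimensional laws) need not give measurable or i.i.d. X_n, and the claim can fail. *)

theory Defs
  imports "HOL-Probability.Probability"
begin

text \<open>
  Time is represented by type \<^typ>\<open>real\<close> and only times in \<open>{0..}\<close> matter; waiting times
  \<open>S n\<close> and processes \<open>B n\<close> are indexed by \<open>n \<ge> 1\<close>, the values at \<open>n = 0\<close> being irrelevant.
\<close>

text \<open>
  Processes with measurable sample paths are understood as measurable processes, i.e. as jointly
  measurable in time and chance. Joint measurability makes every path Borel, and is what makes
  time integrals of the process random variables: Borel paths alone do not suffice for that.
\<close>

definition measurable_process :: "'a measure \<Rightarrow> (real \<Rightarrow> 'a \<Rightarrow> real) \<Rightarrow> bool" where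
  "measurable_process M Y \<longleftrightarrow>
     (\<lambda>(t, \<omega>). Y t \<omega>) \<in> borel_measurable (restrict_space borel {0..} \<Otimes>\<^sub>M M)"

text \<open>
  A process as a random element of the space of functions on \<open>{0..}\<close> with the product
  sigma-algebra, so that its law is given by the finite-dimensional distributions.
\<close>

definition path_space :: "(real \<Rightarrow> real) measure" where
  "path_space = (\<Pi>\<^sub>M t\<in>{0..}. borel)"

definition sample_path :: "(real \<Rightarrow> 'a \<Rightarrow> real) \<Rightarrow> 'a \<Rightarrow> real \<Rightarrow> real" where
  "sample_path Y \<omega> = (\<lambda>t\<in>{0..}. Y t \<omega>)"

definition iid :: "'a measure \<Rightarrow> 'b measure \<Rightarrow> (nat \<Rightarrow> 'a \<Rightarrow> 'b) \<Rightarrow> bool" where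
  "iid M E Y \<longleftrightarrow>
     prob_space.indep_vars M (\<lambda>_. E) Y {1..} \<and>
     (\<forall>n\<ge>1. distr M E (Y n) = distr M E (Y 1))"

text \<open>
  Independence of two random elements, in terms of the generated sigma-algebras; the library's
  \<open>indep_var\<close> requires both to take values in the same type.
\<close>

definition indep_elements ::
    "'a measure \<Rightarrow> 'b measure \<Rightarrow> ('a \<Rightarrow> 'b) \<Rightarrow> 'c measure \<Rightarrow> ('a \<Rightarrow> 'c) \<Rightarrow> bool" where
  "indep_elements M E X E' Y \<longleftrightarrow>
     X \<in> measurable M E \<and> Y \<in> measurable M E' \<and>
     prob_space.indep_set M {X -` A \<inter> space M |A. A \<in> sets E} {Y -` A \<inter> space M |A. A \<in> sets E'}"

definition reset_time :: "(nat \<Rightarrow> 'a \<Rightarrow> real) \<Rightarrow> nat \<Rightarrow> 'a \<Rightarrow> real" where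
  "reset_time S n \<omega> = (\<Sum>i=1..n. S i \<omega>)"

text \<open>
  \<^const>\<open>Sup\<close> of an infinite set of naturals is an unspecified number; for the waiting times below
  this concerns a null event only.
\<close>

definition num_resets :: "(nat \<Rightarrow> 'a \<Rightarrow> real) \<Rightarrow> real \<Rightarrow> 'a \<Rightarrow> nat" where
  "num_resets S t \<omega> = Sup {n. reset_time S n \<omega> \<le> t}"

definition reset_process ::
    "(nat \<Rightarrow> 'a \<Rightarrow> real) \<Rightarrow> (nat \<Rightarrow> real \<Rightarrow> 'a \<Rightarrow> real) \<Rightarrow> real \<Rightarrow> 'a \<Rightarrow> real" where
  "reset_process S B t \<omega> =
     B (num_resets S t \<omega> + 1) (t - reset_time S (num_resets S t \<omega>) \<omega>) \<omega>"

definition additive_functional ::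
    "(real \<Rightarrow> real) \<Rightarrow> (nat \<Rightarrow> 'a \<Rightarrow> real) \<Rightarrow> (nat \<Rightarrow> real \<Rightarrow> 'a \<Rightarrow> real) \<Rightarrow> real \<Rightarrow> 'a \<Rightarrow> real" where
  "additive_functional f S B t \<omega> = (LINT \<tau>:{0..t}|lborel. f (reset_process S B \<tau> \<omega>))"

definition cycle_reward ::
    "(real \<Rightarrow> real) \<Rightarrow> (nat \<Rightarrow> 'a \<Rightarrow> real) \<Rightarrow> (nat \<Rightarrow> real \<Rightarrow> 'a \<Rightarrow> real) \<Rightarrow> nat \<Rightarrow> 'a \<Rightarrow> real" where
  "cycle_reward f S B n \<omega> = (LINT \<tau>:{0..S n \<omega>}|lborel. f (B n \<tau> \<omega>))"

text \<open>
  Extended-valued, since the Bochner integral would return 0 where the integral diverges.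
\<close>

definition cycle_abs_reward ::
    "(real \<Rightarrow> real) \<Rightarrow> (nat \<Rightarrow> 'a \<Rightarrow> real) \<Rightarrow> (nat \<Rightarrow> real \<Rightarrow> 'a \<Rightarrow> real) \<Rightarrow> nat \<Rightarrow> 'a \<Rightarrow> ennreal" where
  "cycle_abs_reward f S B n \<omega> = (\<integral>\<^sup>+\<tau>\<in>{0..S n \<omega>}. ennreal \<bar>f (B n \<tau> \<omega>)\<bar> \<partial>lborel)"

end

theory Submission
  imports Defs
begin

text \<open>
  Cut the time axis at the resets. By time \<open>t\<close> the additive functional has collected the rewards of the
  completed cycles and a part of the running one, so that
  
    \<open>F t - \<mu> * t = (\<Sum>n=1..N t. X n - \<mu> * S n) + rest\<close>,
  
  where the rest is at most the absolute reward of the running cycle plus \<open>\<bar>\<mu>\<bar>\<close> times its length. The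
  choice of \<open>\<mu>\<close> centres the summands, and their common variance is \<open>v * E(S 1)\<close>. The number \<open>N t\<close> of
  resets is close to \<open>t / E(S 1)\<close> in probability (\<open>num_resets_weak_law\<close>). Anscombe's theorem, that a
  central limit theorem may be evaluated at such a random index, therefore gives a Gaussian limit with
  variance \<open>v\<close> for the sum divided by \<open>sqrt t\<close>. The rest is at most the largest of about
  \<open>t / E(S 1)\<close> identically distributed square-integrable variables, which is of smaller order than
  \<open>sqrt t\<close>. Both arguments are in \<open>Anscombe_clt_with_remainder\<close>, which rests on Kolmogorov's
  maximal inequality and the central limit theorem for sums with a deterministic number of terms. The
  maximal inequality is the tool because \<open>N t\<close> and the summands are in general dependent: it bounds the
  sums at all indices of a block simultaneously.
  
  A point that is usually passed over is why the pairs of \<open>X n\<close> and \<open>S n\<close> are independent and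
  identically distributed. The assumptions concern the processes as random elements of a product space,
  thus only their finite-dimensional distributions, and the reward of a cycle need not be a measurable
  function of waiting time and path in that space. By joint measurability it is almost surely equal to
  such a function, the same for all cycles (\<open>time_integral_eq_functional\<close>).
\<close>

section \<open>Second moments and a maximal inequality\<close>

lemma (in prob_space) identically_distributed:
  fixes g :: "'b \<Rightarrow> real"
  assumes X: "X \<in> measurable M N" and Y: "Y \<in> measurable M N" and law: "distr M N X = distr M N Y"
    and g: "g \<in> borel_measurable N"
  shows "integrable M (\<lambda>\<omega>. g (X \<omega>)) \<longleftrightarrow> integrable M (\<lambda>\<omega>. g (Y \<omega>))"
    and "expectation (\<lambda>\<omega>. g (X \<omega>)) = expectation (\<lambda>\<omega>. g (Y \<omega>))"
    and "distr M borel (\<lambda>\<omega>. g (X \<omega>)) = distr M borel (\<lambda>\<omega>. g (Y \<omega>))"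
proof -
  show "integrable M (\<lambda>\<omega>. g (X \<omega>)) \<longleftrightarrow> integrable M (\<lambda>\<omega>. g (Y \<omega>))"
    using integrable_distr_eq[OF X g] integrable_distr_eq[OF Y g] law by simp
  show "expectation (\<lambda>\<omega>. g (X \<omega>)) = expectation (\<lambda>\<omega>. g (Y \<omega>))"
    using integral_distr[OF X g] integral_distr[OF Y g] law by simp
  show "distr M borel (\<lambda>\<omega>. g (X \<omega>)) = distr M borel (\<lambda>\<omega>. g (Y \<omega>))"
    using distr_distr[OF g X] distr_distr[OF g Y] law by (simp add: comp_def)
qed

lemma (in prob_space) second_moment_sum_indep:
  fixes X :: "'i \<Rightarrow> 'a \<Rightarrow> real"
  assumes fin: "finite I" and ind: "indep_vars (\<lambda>_. borel) X I"
    and sq: "\<And>i. i \<in> I \<Longrightarrow> integrable M (\<lambda>\<omega>. (X i \<omega>)\<^sup>2)"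
    and mean: "\<And>i. i \<in> I \<Longrightarrow> expectation (X i) = 0"
  shows "integrable M (\<lambda>\<omega>. (\<Sum>i\<in>I. X i \<omega>)\<^sup>2)"
    and "expectation (\<lambda>\<omega>. (\<Sum>i\<in>I. X i \<omega>)\<^sup>2) = (\<Sum>i\<in>I. expectation (\<lambda>\<omega>. (X i \<omega>)\<^sup>2))"
proof -
  have rv: "random_variable borel (X i)" if "i \<in> I" for i
    using ind that by (auto simp: indep_vars_def)
  have int: "integrable M (X i)" if "i \<in> I" for i
    using rv[OF that] sq[OF that] by (rule square_integrable_imp_integrable)
  have "integrable M (\<lambda>\<omega>. (\<Sum>i\<in>I. X i \<omega>)\<^sup>2) \<and>
    expectation (\<lambda>\<omega>. (\<Sum>i\<in>I. X i \<omega>)\<^sup>2) = (\<Sum>i\<in>I. expectation (\<lambda>\<omega>. (X i \<omega>)\<^sup>2))"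
    using fin subset_refl[of I]
  proof (induction rule: finite_subset_induct')
    case empty
    then show ?case by simp
  next
    case (insert a J)
    have indJ: "indep_vars (\<lambda>_. borel) X (insert a J)"
      by (rule indep_vars_subset[OF ind]) (use insert in auto)
    have cross: "indep_var borel (X a) borel (\<lambda>\<omega>. \<Sum>i\<in>J. X i \<omega>)"
      using insert indJ by (intro indep_vars_sum) auto
    have intJ: "integrable M (\<lambda>\<omega>. \<Sum>i\<in>J. X i \<omega>)"
      using insert int by (intro Bochner_Integration.integrable_sum) auto
    have 1: "integrable M (\<lambda>\<omega>. X a \<omega> * (\<Sum>i\<in>J. X i \<omega>))"
      using cross int[OF \<open>a \<in> I\<close>] intJ by (rule indep_var_integrable)
    have 2: "expectation (\<lambda>\<omega>. X a \<omega> * (\<Sum>i\<in>J. X i \<omega>)) = 0"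
      using indep_var_lebesgue_integral[OF cross int[OF \<open>a \<in> I\<close>] intJ] mean[OF \<open>a \<in> I\<close>] by simp
    have 3: "(\<Sum>i\<in>insert a J. X i \<omega>)\<^sup>2 =
        (X a \<omega>)\<^sup>2 + (\<Sum>i\<in>J. X i \<omega>)\<^sup>2 + 2 * (X a \<omega> * (\<Sum>i\<in>J. X i \<omega>))" for \<omega>
      using insert by (simp add: power2_eq_square algebra_simps)
    show ?case
      unfolding 3 using insert sq[OF \<open>a \<in> I\<close>] 1 2 by simp
  qed
  then show "integrable M (\<lambda>\<omega>. (\<Sum>i\<in>I. X i \<omega>)\<^sup>2)"
    and "expectation (\<lambda>\<omega>. (\<Sum>i\<in>I. X i \<omega>)\<^sup>2) = (\<Sum>i\<in>I. expectation (\<lambda>\<omega>. (X i \<omega>)\<^sup>2))"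
    by auto
qed

text \<open>
  Split the event according to the first index at which the partial sum leaves the interval
  around 0. The rest of the sum is independent of that first passage and centred, so stopping at
  the passage can only lower the second moment; Markov's inequality at the passage sums up to
  the bound that Chebyshev's inequality gives for the last partial sum alone.
\<close>

lemma (in prob_space) Kolmogorov_maximal_inequality:
  fixes X :: "nat \<Rightarrow> 'a \<Rightarrow> real"
  assumes ind: "indep_vars (\<lambda>_. borel) X {..<n}"
    and sq: "\<And>i. i < n \<Longrightarrow> integrable M (\<lambda>\<omega>. (X i \<omega>)\<^sup>2)"
    and mean: "\<And>i. i < n \<Longrightarrow> expectation (X i) = 0"
    and "0 < \<epsilon>"
  shows "prob {\<omega> \<in> space M. \<exists>k\<le>n. \<epsilon> \<le> \<bar>\<Sum>i<k. X i \<omega>\<bar>} \<le>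
    (\<Sum>i<n. expectation (\<lambda>\<omega>. (X i \<omega>)\<^sup>2)) / \<epsilon>\<^sup>2"
proof -
  define P where "P k \<omega> = (\<Sum>i<k. X i \<omega>)" for k \<omega>
  define E where "E k = {\<omega> \<in> space M. \<epsilon> \<le> \<bar>P k \<omega>\<bar> \<and> (\<forall>j<k. \<bar>P j \<omega>\<bar> < \<epsilon>)}" for k
  have rv: "random_variable borel (X i)" if "i < n" for i
    using ind that by (auto simp: indep_vars_def)
  have P_rv: "random_variable borel (P k)" if "k \<le> n" for k
    unfolding P_def using rv that by (intro borel_measurable_sum) auto
  have E_sets: "E k \<in> events" if "k \<le> n" for k
  proof -
    have "Measurable.pred M (\<lambda>\<omega>. \<forall>j\<in>{..<k}. \<bar>P j \<omega>\<bar> < \<epsilon>)"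
      using that by (intro pred_intros_finite borel_measurable_pred_less borel_measurable_abs P_rv) auto
    then have "{\<omega> \<in> space M. \<forall>j\<in>{..<k}. \<bar>P j \<omega>\<bar> < \<epsilon>} \<in> events"
      by (simp add: pred_def)
    moreover have "{\<omega> \<in> space M. \<epsilon> \<le> \<bar>P k \<omega>\<bar>} \<in> events"
      by (intro borel_measurable_le borel_measurable_abs P_rv that) auto
    moreover have "E k = {\<omega> \<in> space M. \<epsilon> \<le> \<bar>P k \<omega>\<bar>} \<inter> {\<omega> \<in> space M. \<forall>j\<in>{..<k}. \<bar>P j \<omega>\<bar> < \<epsilon>}"
      by (auto simp: E_def)
    ultimately show ?thesis
      by auto
  qed
  have P_sq: "integrable M (\<lambda>\<omega>. (P k \<omega>)\<^sup>2)" if "k \<le> n" for k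
    unfolding P_def using that
    by (intro second_moment_sum_indep(1) indep_vars_subset[OF ind] sq mean) auto
  have P_int: "integrable M (P k)" if "k \<le> n" for k
    using P_rv[OF that] P_sq[OF that] by (rule square_integrable_imp_integrable)
  \<comment> \<open>On \<open>E k\<close> write \<open>P n = P k + (P n - P k)\<close>. The increment is independent of \<open>P k\<close> and \<open>E k\<close>, so
    the mixed term of the square has expectation 0.\<close>
  have step: "\<epsilon>\<^sup>2 * prob (E k) \<le> expectation (\<lambda>\<omega>. (P n \<omega>)\<^sup>2 * indicator (E k) \<omega>)"
    if k: "k \<le> n" for k
  proof -
    let ?g = "\<lambda>x :: nat \<Rightarrow> real. (\<Sum>i<k. x i) * (if \<epsilon> \<le> \<bar>\<Sum>i<k. x i\<bar> \<and> (\<forall>j\<in>{..<k}. \<bar>\<Sum>i<j. x i\<bar> < \<epsilon>) then 1 else 0)"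
    let ?h = "\<lambda>x :: nat \<Rightarrow> real. \<Sum>i\<in>{k..<n}. x i"
    have s: "(\<lambda>x :: nat \<Rightarrow> real. \<Sum>i<j. x i) \<in> borel_measurable (Pi\<^sub>M {..<k} (\<lambda>_. borel))" if "j \<le> k" for j
      using that by (intro borel_measurable_sum measurable_component_singleton) auto
    have "{x \<in> space (Pi\<^sub>M {..<k} (\<lambda>_. borel)). \<epsilon> \<le> \<bar>\<Sum>i<k. x i\<bar>} \<inter>
        {x \<in> space (Pi\<^sub>M {..<k} (\<lambda>_. borel)). \<forall>j\<in>{..<k}. \<bar>\<Sum>i<j. x i\<bar> < \<epsilon>} \<in> sets (Pi\<^sub>M {..<k} (\<lambda>_. borel :: real measure))"
      by (intro sets.Int sets.sets_Collect_finite_All borel_measurable_le borel_measurable_less borel_measurable_abs s) auto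
    then have g: "?g \<in> borel_measurable (Pi\<^sub>M {..<k} (\<lambda>_. borel))"
      by (intro borel_measurable_times s measurable_If) (auto simp: Int_def conj_ac)
    have h: "?h \<in> borel_measurable (Pi\<^sub>M {k..<n} (\<lambda>_. borel))"
      by (intro borel_measurable_sum measurable_component_singleton) auto
    have "indep_var (Pi\<^sub>M {..<k} (\<lambda>_. borel)) (\<lambda>\<omega>. restrict (\<lambda>i. X i \<omega>) {..<k})
        (Pi\<^sub>M {k..<n} (\<lambda>_. borel)) (\<lambda>\<omega>. restrict (\<lambda>i. X i \<omega>) {k..<n})"
      using k by (intro indep_var_restrict[OF ind]) auto
    from indep_var_compose[OF this g h]
    have ind': "indep_var borel (?g \<circ> (\<lambda>\<omega>. restrict (\<lambda>i. X i \<omega>) {..<k})) borel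
        (?h \<circ> (\<lambda>\<omega>. restrict (\<lambda>i. X i \<omega>) {k..<n}))" .
    have g_eq: "(?g \<circ> (\<lambda>\<omega>. restrict (\<lambda>i. X i \<omega>) {..<k})) \<omega> = P k \<omega> * indicator (E k) \<omega>"
      if "\<omega> \<in> space M" for \<omega>
      using that by (auto simp: E_def P_def restrict_def indicator_def cong: sum.cong_simp)
    have split: "P n \<omega> = P k \<omega> + (\<Sum>i\<in>{k..<n}. X i \<omega>)" for \<omega>
      unfolding P_def using sum.atLeastLessThan_concat[of 0 k n "\<lambda>i. X i \<omega>"] k
      by (simp add: atLeast0LessThan)
    then have h_eq: "(?h \<circ> (\<lambda>\<omega>. restrict (\<lambda>i. X i \<omega>) {k..<n})) \<omega> = P n \<omega> - P k \<omega>" for \<omega>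
      by (simp cong: sum.cong_simp)
    have h_fun: "(?h \<circ> (\<lambda>\<omega>. restrict (\<lambda>i. X i \<omega>) {k..<n})) = (\<lambda>\<omega>. P n \<omega> - P k \<omega>)"
      using h_eq by (rule ext)
    have int1: "integrable M (\<lambda>\<omega>. P k \<omega> * indicator (E k) \<omega>)"
      by (intro integrable_real_mult_indicator E_sets P_int k)
    have int_g: "integrable M (?g \<circ> (\<lambda>\<omega>. restrict (\<lambda>i. X i \<omega>) {..<k}))"
      by (rule Bochner_Integration.integrable_cong[THEN iffD2, OF refl _ int1]) (simp only: g_eq)
    have int2: "integrable M (\<lambda>\<omega>. P n \<omega> - P k \<omega>)"
      by (intro Bochner_Integration.integrable_diff P_int k order_refl)
    have "expectation (\<lambda>\<omega>. \<Sum>i\<in>{k..<n}. X i \<omega>) = (\<Sum>i\<in>{k..<n}. expectation (X i))"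
      by (intro Bochner_Integration.integral_sum square_integrable_imp_integrable[OF rv sq]) auto
    then have mean2: "expectation (\<lambda>\<omega>. P n \<omega> - P k \<omega>) = 0"
      using mean by (simp add: split)
    have int3: "integrable M (\<lambda>\<omega>. P k \<omega> * indicator (E k) \<omega> * (P n \<omega> - P k \<omega>))"
      by (rule Bochner_Integration.integrable_cong[THEN iffD1, OF refl _
            indep_var_integrable[OF ind' int_g, unfolded h_fun, OF int2]]) (simp only: g_eq)
    have "expectation (\<lambda>\<omega>. P k \<omega> * indicator (E k) \<omega> * (P n \<omega> - P k \<omega>)) =
        expectation (\<lambda>\<omega>. (?g \<circ> (\<lambda>\<omega>. restrict (\<lambda>i. X i \<omega>) {..<k})) \<omega> * (P n \<omega> - P k \<omega>))"
      by (rule Bochner_Integration.integral_cong[OF refl]) (simp only: g_eq)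
    also have "\<dots> = 0"
      using indep_var_lebesgue_integral[OF ind' int_g, unfolded h_fun, OF int2] mean2 by simp
    finally have zero: "expectation (\<lambda>\<omega>. P k \<omega> * indicator (E k) \<omega> * (P n \<omega> - P k \<omega>)) = 0" .
    have "\<epsilon>\<^sup>2 * prob (E k) = expectation (\<lambda>\<omega>. \<epsilon>\<^sup>2 * indicator (E k) \<omega>)"
      using E_sets[OF k] by simp
    also have "\<dots> \<le> expectation (\<lambda>\<omega>. (P n \<omega>)\<^sup>2 * indicator (E k) \<omega> - 2 * (P k \<omega> * indicator (E k) \<omega> * (P n \<omega> - P k \<omega>)))"
    proof (rule integral_mono)
      show "integrable M (\<lambda>\<omega>. \<epsilon>\<^sup>2 * indicator (E k) \<omega> :: real)"
        using E_sets[OF k] by (simp add: emeasure_eq_measure)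
      show "integrable M (\<lambda>\<omega>. (P n \<omega>)\<^sup>2 * indicator (E k) \<omega> - 2 * (P k \<omega> * indicator (E k) \<omega> * (P n \<omega> - P k \<omega>)))"
        using int3 by (intro Bochner_Integration.integrable_diff integrable_real_mult_indicator E_sets k P_sq) auto
      fix \<omega>
      have "\<epsilon>\<^sup>2 \<le> (P k \<omega>)\<^sup>2" if "\<omega> \<in> E k"
        using that \<open>0 < \<epsilon>\<close> by (simp add: E_def abs_le_square_iff[symmetric])
      moreover have "(P k \<omega>)\<^sup>2 \<le> (P n \<omega>)\<^sup>2 - 2 * (P k \<omega> * (P n \<omega> - P k \<omega>))"
        using zero_le_power2[of "P n \<omega> - P k \<omega>"] by (simp add: power2_eq_square algebra_simps)
      ultimately show "\<epsilon>\<^sup>2 * indicator (E k) \<omega> \<le>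
          (P n \<omega>)\<^sup>2 * indicator (E k) \<omega> - 2 * (P k \<omega> * indicator (E k) \<omega> * (P n \<omega> - P k \<omega>))"
        by (auto simp: indicator_def)
    qed
    also have "\<dots> = expectation (\<lambda>\<omega>. (P n \<omega>)\<^sup>2 * indicator (E k) \<omega>)"
      using int3 zero E_sets[OF k] P_sq[of n]
      by (subst Bochner_Integration.integral_diff) (auto intro!: integrable_real_mult_indicator)
    finally show ?thesis .
  qed
  have "{\<omega> \<in> space M. \<exists>k\<le>n. \<epsilon> \<le> \<bar>\<Sum>i<k. X i \<omega>\<bar>} = (\<Union>k\<le>n. E k)"
  proof (intro set_eqI iffI)
    fix \<omega> assume "\<omega> \<in> {\<omega> \<in> space M. \<exists>k\<le>n. \<epsilon> \<le> \<bar>\<Sum>i<k. X i \<omega>\<bar>}"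
    then obtain k where \<omega>: "\<omega> \<in> space M" and k: "k \<le> n" "\<epsilon> \<le> \<bar>P k \<omega>\<bar>"
      by (auto simp: P_def)
    define j where "j = (LEAST j. \<epsilon> \<le> \<bar>P j \<omega>\<bar>)"
    have "\<epsilon> \<le> \<bar>P j \<omega>\<bar>" "j \<le> k"
      unfolding j_def using k(2) by (auto intro: LeastI Least_le)
    moreover have "\<bar>P i \<omega>\<bar> < \<epsilon>" if "i < j" for i
      using not_less_Least[OF that[unfolded j_def]] by simp
    ultimately show "\<omega> \<in> (\<Union>k\<le>n. E k)"
      using \<omega> k by (auto simp: E_def intro!: bexI[of _ j])
  qed (auto simp: E_def P_def)
  moreover have disj: "disjoint_family_on E {..n}"
    unfolding disjoint_family_on_def
  proof (intro ballI impI)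
    fix i j :: nat assume "i \<noteq> j"
    then show "E i \<inter> E j = {}"
      by (cases i j rule: linorder_cases) (force simp: E_def)+
  qed
  ultimately have "\<epsilon>\<^sup>2 * prob {\<omega> \<in> space M. \<exists>k\<le>n. \<epsilon> \<le> \<bar>\<Sum>i<k. X i \<omega>\<bar>} = (\<Sum>k\<le>n. \<epsilon>\<^sup>2 * prob (E k))"
    using E_sets by (simp add: finite_measure_finite_Union sum_distrib_left image_subset_iff)
  also have "\<dots> \<le> (\<Sum>k\<le>n. expectation (\<lambda>\<omega>. (P n \<omega>)\<^sup>2 * indicator (E k) \<omega>))"
    by (intro sum_mono step) auto
  also have "\<dots> = expectation (\<lambda>\<omega>. \<Sum>k\<le>n. (P n \<omega>)\<^sup>2 * indicator (E k) \<omega>)"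
    using E_sets P_sq[of n]
    by (intro Bochner_Integration.integral_sum[symmetric] integrable_real_mult_indicator) auto
  also have "\<dots> \<le> expectation (\<lambda>\<omega>. (P n \<omega>)\<^sup>2)"
  proof (rule integral_mono)
    show "integrable M (\<lambda>\<omega>. \<Sum>k\<le>n. (P n \<omega>)\<^sup>2 * indicator (E k) \<omega>)"
      using E_sets P_sq[of n] by (intro Bochner_Integration.integrable_sum integrable_real_mult_indicator) auto
    have "(\<Sum>k\<le>n. indicator (E k) \<omega>) = (indicator (\<Union>k\<le>n. E k) \<omega> :: real)" for \<omega>
      using disj by (intro indicator_UN_disjoint[symmetric]) auto
    then show "(\<Sum>k\<le>n. (P n \<omega>)\<^sup>2 * indicator (E k) \<omega>) \<le> (P n \<omega>)\<^sup>2" for \<omega>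
      by (simp add: sum_distrib_left[symmetric] indicator_def)
  qed (use P_sq in auto)
  also have "\<dots> = (\<Sum>i<n. expectation (\<lambda>\<omega>. (X i \<omega>)\<^sup>2))"
    unfolding P_def using ind sq mean by (intro second_moment_sum_indep(2)) auto
  finally show ?thesis
    using \<open>0 < \<epsilon>\<close> by (simp add: field_simps)
qed

lemma (in prob_space) prob_abs_ge_le_second_moment:
  fixes X :: "'a \<Rightarrow> real"
  assumes rv: "random_variable borel X" and sq: "integrable M (\<lambda>\<omega>. (X \<omega>)\<^sup>2)" and a: "0 < a"
  shows "prob {\<omega> \<in> space M. a \<le> \<bar>X \<omega>\<bar>} \<le> expectation (\<lambda>\<omega>. (X \<omega>)\<^sup>2) / a\<^sup>2"
proof -
  have "prob {\<omega> \<in> space M. a\<^sup>2 \<le> (X \<omega>)\<^sup>2} \<le> expectation (\<lambda>\<omega>. (X \<omega>)\<^sup>2) / a\<^sup>2"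
    using sq a by (intro integral_Markov_inequality_measure[where A="space M"]) auto
  also have "{\<omega> \<in> space M. a\<^sup>2 \<le> (X \<omega>)\<^sup>2} = {\<omega> \<in> space M. a \<le> \<bar>X \<omega>\<bar>}"
    using a by (auto simp: abs_le_square_iff[symmetric])
  finally show ?thesis .
qed

section \<open>A central limit theorem for randomly stopped sums\<close>

lemma (in prob_space) Slutsky_cdf:
  fixes U V :: "'b \<Rightarrow> 'a \<Rightarrow> real"
  assumes U: "\<And>t. random_variable borel (U t)" and V: "\<And>t. random_variable borel (V t)"
    and conv: "\<And>x. ((\<lambda>t. prob {\<omega> \<in> space M. U t \<omega> \<le> x}) \<longlongrightarrow> F x) G"
    and cont: "isCont F z"
    and diff: "\<And>\<epsilon>. 0 < \<epsilon> \<Longrightarrow> ((\<lambda>t. prob {\<omega> \<in> space M. \<epsilon> \<le> \<bar>V t \<omega> - U t \<omega>\<bar>}) \<longlongrightarrow> 0) G"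
  shows "((\<lambda>t. prob {\<omega> \<in> space M. V t \<omega> \<le> z}) \<longlongrightarrow> F z) G"
proof (rule order_tendstoI)
  have ev: "{\<omega> \<in> space M. U t \<omega> \<le> x} \<in> events" "{\<omega> \<in> space M. V t \<omega> \<le> x} \<in> events"
    "{\<omega> \<in> space M. \<epsilon> \<le> \<bar>V t \<omega> - U t \<omega>\<bar>} \<in> events" for t x \<epsilon>
    using U[of t] V[of t] by measurable
  have near: "\<exists>d>0. \<forall>x. \<bar>x - z\<bar> \<le> d \<longrightarrow> F x \<in> S" if "open S" "F z \<in> S" for S
  proof -
    have "\<forall>\<^sub>F x in nhds z. F x \<in> S"
      using cont that unfolding isCont_def tendsto_at_iff_tendsto_nhds by (rule topological_tendstoD)
    then obtain d where "0 < d" "\<And>x. dist x z < d \<Longrightarrow> F x \<in> S"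
      by (auto simp: eventually_nhds_metric)
    then show ?thesis
      by (intro exI[of _ "d / 2"]) (auto simp: dist_real_def)
  qed
  {
    fix a assume "a < F z"
    with near[of "{a<..}"] obtain d where d: "0 < d" and "\<forall>x. \<bar>x - z\<bar> \<le> d \<longrightarrow> a < F x"
      by auto
    then have "a < F (z - d) - 0"
      by simp
    then have "\<forall>\<^sub>F t in G. a < prob {\<omega> \<in> space M. U t \<omega> \<le> z - d} - prob {\<omega> \<in> space M. d \<le> \<bar>V t \<omega> - U t \<omega>\<bar>}"
      by (intro order_tendstoD(1)[OF tendsto_diff[OF conv diff[OF d]]])
    then show "\<forall>\<^sub>F t in G. a < prob {\<omega> \<in> space M. V t \<omega> \<le> z}"
    proof eventually_elim
      case (elim t)
      have "prob {\<omega> \<in> space M. U t \<omega> \<le> z - d} \<le>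
          prob ({\<omega> \<in> space M. V t \<omega> \<le> z} \<union> {\<omega> \<in> space M. d \<le> \<bar>V t \<omega> - U t \<omega>\<bar>})"
        using ev by (intro finite_measure_mono) auto
      also have "\<dots> \<le> prob {\<omega> \<in> space M. V t \<omega> \<le> z} + prob {\<omega> \<in> space M. d \<le> \<bar>V t \<omega> - U t \<omega>\<bar>}"
        using ev by (intro measure_Un_le) auto
      finally show ?case using elim by simp
    qed
  next
    fix a assume "F z < a"
    with near[of "{..<a}"] obtain d where d: "0 < d" and "\<forall>x. \<bar>x - z\<bar> \<le> d \<longrightarrow> F x < a"
      by auto
    then have "F (z + d) + 0 < a"
      by simp
    then have "\<forall>\<^sub>F t in G. prob {\<omega> \<in> space M. U t \<omega> \<le> z + d} + prob {\<omega> \<in> space M. d \<le> \<bar>V t \<omega> - U t \<omega>\<bar>} < a"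
      by (intro order_tendstoD(2)[OF tendsto_add[OF conv diff[OF d]]])
    then show "\<forall>\<^sub>F t in G. prob {\<omega> \<in> space M. V t \<omega> \<le> z} < a"
    proof eventually_elim
      case (elim t)
      have "prob {\<omega> \<in> space M. V t \<omega> \<le> z} \<le>
          prob ({\<omega> \<in> space M. U t \<omega> \<le> z + d} \<union> {\<omega> \<in> space M. d \<le> \<bar>V t \<omega> - U t \<omega>\<bar>})"
        using ev by (intro finite_measure_mono) auto
      also have "\<dots> \<le> prob {\<omega> \<in> space M. U t \<omega> \<le> z + d} + prob {\<omega> \<in> space M. d \<le> \<bar>V t \<omega> - U t \<omega>\<bar>}"
        using ev by (intro measure_Un_le) auto
      finally show ?case using elim by simp
    qed
  }
qed

text \<open>
  Strengthens the bound \<open>O(1)\<close> of Markov's inequality to \<open>o(1)\<close>: the second moment over the tail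
  event vanishes by dominated convergence. This is what makes the largest of about \<open>t\<close> identically
  distributed square-integrable variables negligible against \<open>sqrt t\<close>, by a union bound.
\<close>

lemma (in prob_space) tail_prob_square_integrable:
  fixes W :: "'a \<Rightarrow> real"
  assumes rv [measurable]: "random_variable borel W" and sq: "integrable M (\<lambda>\<omega>. (W \<omega>)\<^sup>2)" and \<epsilon>: "0 < \<epsilon>"
  shows "((\<lambda>t. t * prob {\<omega> \<in> space M. \<epsilon> * sqrt t \<le> W \<omega>}) \<longlongrightarrow> 0) at_top"
proof -
  let ?s = "\<lambda>t \<omega>. (W \<omega>)\<^sup>2 * indicator {\<omega> \<in> space M. \<epsilon> * sqrt t \<le> W \<omega>} \<omega>"
  have "((\<lambda>t. expectation (?s t)) \<longlongrightarrow> expectation (\<lambda>_. 0)) at_top"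
  proof (rule integral_dominated_convergence_at_top)
    show "integrable M (\<lambda>\<omega>. (W \<omega>)\<^sup>2)"
      by (fact sq)
    show "\<forall>\<^sub>F t in at_top. AE \<omega> in M. norm (?s t \<omega>) \<le> (W \<omega>)\<^sup>2"
      by (auto simp: indicator_def)
    show "AE \<omega> in M. ((\<lambda>t. ?s t \<omega>) \<longlongrightarrow> 0) at_top"
    proof (intro AE_I2 tendsto_eventually)
      fix \<omega>
      have "filterlim (\<lambda>t. \<epsilon> * sqrt t) at_top at_top"
        using \<epsilon> by (intro filterlim_tendsto_pos_mult_at_top[OF tendsto_const] sqrt_at_top) auto
      then have "\<forall>\<^sub>F t in at_top. W \<omega> < \<epsilon> * sqrt t"
        by (simp add: filterlim_at_top_dense)
      then show "\<forall>\<^sub>F t in at_top. ?s t \<omega> = 0"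
        by eventually_elim (simp add: indicator_def)
    qed
  qed auto
  then have lim: "((\<lambda>t. expectation (?s t) / \<epsilon>\<^sup>2) \<longlongrightarrow> 0) at_top"
    using tendsto_divide_zero by force
  have le: "t * prob {\<omega> \<in> space M. \<epsilon> * sqrt t \<le> W \<omega>} \<le> expectation (?s t) / \<epsilon>\<^sup>2" if "0 \<le> t" for t
  proof -
    have "\<epsilon>\<^sup>2 * t * prob {\<omega> \<in> space M. \<epsilon> * sqrt t \<le> W \<omega>} =
        expectation (\<lambda>\<omega>. \<epsilon>\<^sup>2 * t * indicator {\<omega> \<in> space M. \<epsilon> * sqrt t \<le> W \<omega>} \<omega>)"
      by simp
    also have "\<dots> \<le> expectation (?s t)"
    proof (rule integral_mono)
      show "integrable M (\<lambda>\<omega>. \<epsilon>\<^sup>2 * t * indicator {\<omega> \<in> space M. \<epsilon> * sqrt t \<le> W \<omega>} \<omega>)"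
        by (intro integrable_real_mult_indicator) auto
      show "integrable M (?s t)"
        by (intro integrable_real_mult_indicator sq) auto
      fix \<omega>
      have "\<epsilon>\<^sup>2 * t \<le> (W \<omega>)\<^sup>2" if "\<epsilon> * sqrt t \<le> W \<omega>"
        using power_mono[OF that, of 2] \<open>0 \<le> t\<close> \<epsilon> by (simp add: power_mult_distrib)
      then show "\<epsilon>\<^sup>2 * t * indicator {\<omega> \<in> space M. \<epsilon> * sqrt t \<le> W \<omega>} \<omega> \<le> ?s t \<omega>"
        by (auto simp: indicator_def)
    qed
    finally show ?thesis
      using \<epsilon> by (simp add: field_simps)
  qed
  show ?thesis
  proof (rule tendsto_sandwich[OF _ _ tendsto_const lim])
    show "\<forall>\<^sub>F t in at_top. 0 \<le> t * prob {\<omega> \<in> space M. \<epsilon> * sqrt t \<le> W \<omega>}"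
      using eventually_ge_at_top[of 0] by eventually_elim simp
    show "\<forall>\<^sub>F t in at_top. t * prob {\<omega> \<in> space M. \<epsilon> * sqrt t \<le> W \<omega>} \<le> expectation (?s t) / \<epsilon>\<^sup>2"
      using eventually_ge_at_top[of 0] by eventually_elim (rule le)
  qed
qed

lemma (in prob_space) cdf_normalized_sums_tendsto:
  fixes Y :: "nat \<Rightarrow> 'a \<Rightarrow> real"
  assumes ind: "indep_vars (\<lambda>_. borel) Y UNIV"
    and law: "\<And>n. distr M borel (Y n) = distr M borel (Y 0)"
    and sq: "integrable M (\<lambda>\<omega>. (Y 0 \<omega>)\<^sup>2)"
    and mean: "expectation (Y 0) = 0"
    and s: "expectation (\<lambda>\<omega>. (Y 0 \<omega>)\<^sup>2) = s" "0 < s"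
  shows "(\<lambda>n. prob {\<omega> \<in> space M. (\<Sum>i<n. Y i \<omega>) / sqrt (real n * s) \<le> x}) \<longlonglongrightarrow> cdf std_normal_distribution x"
    and "isCont (cdf std_normal_distribution) x"
proof -
  have rv: "random_variable borel (Y n)" for n
    using ind by (auto simp: indep_vars_def)
  have sqn: "integrable M (\<lambda>\<omega>. (Y n \<omega>)\<^sup>2)" for n
    using sq identically_distributed(1)[OF rv rv law, of "\<lambda>x. x\<^sup>2" n] by simp
  have meann: "expectation (Y n) = 0" for n
    using mean identically_distributed(2)[OF rv rv law, of "\<lambda>x. x" n] by simp
  have sn: "expectation (\<lambda>\<omega>. (Y n \<omega>)\<^sup>2) = s" for n
    using s identically_distributed(2)[OF rv rv law, of "\<lambda>x. x\<^sup>2" n] by simp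
  have clt: "weak_conv_m (\<lambda>n. distr M borel (\<lambda>\<omega>. (\<Sum>i<n. Y i \<omega>) / sqrt (real n * (sqrt s)\<^sup>2))) std_normal_distribution"
    by (rule central_limit_theorem_zero_mean[OF ind meann _ sqn _ law]) (use s sn meann in auto)
  interpret N: real_distribution std_normal_distribution
    by (rule real_dist_normal_dist)
  show cont: "isCont (cdf std_normal_distribution) x"
  proof (subst N.isCont_cdf)
    have "emeasure std_normal_distribution {x} = 0"
      by (subst emeasure_density) (auto intro!: nn_integral_null_set finite_imp_null_set_lborel)
    then show "measure std_normal_distribution {x} = 0"
      by (simp add: measure_def)
  qed
  with clt have "(\<lambda>n. cdf (distr M borel (\<lambda>\<omega>. (\<Sum>i<n. Y i \<omega>) / sqrt (real n * s))) x) \<longlonglongrightarrow> cdf std_normal_distribution x"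
    using s(2) by (simp add: weak_conv_m_def weak_conv_def)
  moreover have "cdf (distr M borel (\<lambda>\<omega>. (\<Sum>i<n. Y i \<omega>) / sqrt (real n * s))) x =
      prob {\<omega> \<in> space M. (\<Sum>i<n. Y i \<omega>) / sqrt (real n * s) \<le> x}" for n
    unfolding cdf_def
    by (subst measure_distr) (auto intro!: arg_cong[where f=prob] borel_measurable_divide borel_measurable_sum rv)
  ultimately show "(\<lambda>n. prob {\<omega> \<in> space M. (\<Sum>i<n. Y i \<omega>) / sqrt (real n * s) \<le> x}) \<longlonglongrightarrow> cdf std_normal_distribution x"
    by simp
qed

lemma cdf_std_normal_distribution:
  "cdf std_normal_distribution z = (LINT x:{..z}|lborel. exp (- (1 / 2) * x\<^sup>2) / sqrt (2 * pi))"
proof -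
  have "cdf std_normal_distribution z = enn2real (\<integral>\<^sup>+x. ennreal (std_normal_density x) * indicator {..z} x \<partial>lborel)"
    by (simp add: cdf_def measure_def emeasure_density)
  also have "(\<integral>\<^sup>+x. ennreal (std_normal_density x) * indicator {..z} x \<partial>lborel) =
      (\<integral>\<^sup>+x. ennreal (indicator {..z} x *\<^sub>R (exp (- (1 / 2) * x\<^sup>2) / sqrt (2 * pi))) \<partial>lborel)"
    by (intro nn_integral_cong) (auto simp: std_normal_density_def indicator_def)
  also have "enn2real \<dots> = (LINT x:{..z}|lborel. exp (- (1 / 2) * x\<^sup>2) / sqrt (2 * pi))"
    unfolding set_lebesgue_integral_def by (intro integral_eq_nn_integral[symmetric]) auto
  finally show ?thesis .
qed

lemma (in prob_space) indep_vars_reindex: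
  assumes ind: "indep_vars (\<lambda>_. N) X (f ` I)" and inj: "inj_on f I"
  shows "indep_vars (\<lambda>_. N) (\<lambda>i. X (f i)) I"
  unfolding indep_vars_def2 indep_sets_def
proof (intro conjI ballI allI impI)
  show "random_variable N (X (f i))" if "i \<in> I" for i
    using ind that by (auto simp: indep_vars_def2)
  show "{X (f i) -` A \<inter> space M |A. A \<in> sets N} \<subseteq> events" if "i \<in> I" for i
    using ind that by (auto simp: indep_vars_def2 indep_sets_def)
  fix J A assume J: "J \<subseteq> I" "J \<noteq> {}" "finite J"
    and A: "A \<in> (\<Pi> i\<in>J. {X (f i) -` A \<inter> space M |A. A \<in> sets N})"
  have injJ: "inj_on f J"
    using inj J by (auto intro: inj_on_subset)
  let ?A = "\<lambda>j. A (inv_into J f j)"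
  have "prob (\<Inter>j\<in>f ` J. ?A j) = (\<Prod>j\<in>f ` J. prob (?A j))"
    using ind J A inv_into_f_f[OF injJ] unfolding indep_vars_def2
    by (intro indep_setsD[where I="f ` I"]) (auto simp: Pi_iff)
  then show "prob (\<Inter>j\<in>J. A j) = (\<Prod>j\<in>J. prob (A j))"
    using inv_into_f_f[OF injJ] by (simp add: prod.reindex[OF injJ])
qed

text \<open>
  The central limit theorem at the deterministic index \<open>m t\<close>, the integer part of \<open>c * t\<close>, carries
  over to the random index \<open>N t\<close>, which may depend on \<open>Y\<close>. With high
  probability \<open>N t\<close> lies within \<open>\<delta> * t\<close> of \<open>c * t\<close>, and over such a block of indices the maximal
  inequality keeps the oscillation of the partial sums of order \<open>sqrt (\<delta> * t)\<close>, which is negligible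
  as \<open>\<delta>\<close> tends to 0. The remainder \<open>W\<close> is taken at the random index as well, and is controlled by
  the maximum of \<open>W\<close> over all indices up to the end of the block.
\<close>

lemma (in prob_space) Anscombe_clt_with_remainder:
  fixes Y W :: "nat \<Rightarrow> 'a \<Rightarrow> real" and N :: "real \<Rightarrow> 'a \<Rightarrow> nat" and F :: "real \<Rightarrow> 'a \<Rightarrow> real"
  assumes ind: "indep_vars (\<lambda>_. borel) Y UNIV"
    and law: "\<And>n. distr M borel (Y n) = distr M borel (Y 0)"
    and sq: "integrable M (\<lambda>\<omega>. (Y 0 \<omega>)\<^sup>2)"
    and mean: "expectation (Y 0) = 0"
    and s: "expectation (\<lambda>\<omega>. (Y 0 \<omega>)\<^sup>2) = s" "0 < s"
    and W [measurable]: "\<And>n. random_variable borel (W n)"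
    and W_law: "\<And>n. distr M borel (W n) = distr M borel (W 0)"
    and W_sq: "integrable M (\<lambda>\<omega>. (W 0 \<omega>)\<^sup>2)"
    and N [measurable]: "\<And>t. N t \<in> measurable M (count_space UNIV)"
    and c: "0 < c"
    and N_lim: "\<And>\<delta>. 0 < \<delta> \<Longrightarrow> ((\<lambda>t. prob {\<omega> \<in> space M. \<delta> * t \<le> \<bar>real (N t \<omega>) - c * t\<bar>}) \<longlongrightarrow> 0) at_top"
    and F [measurable]: "\<And>t. random_variable borel (F t)"
    and bound: "\<And>t. 0 < t \<Longrightarrow> AE \<omega> in M. \<bar>F t \<omega> - (\<Sum>i<N t \<omega>. Y i \<omega>)\<bar> \<le> W (N t \<omega>) \<omega>"
  shows "((\<lambda>t. prob {\<omega> \<in> space M. F t \<omega> / sqrt (c * s * t) \<le> z}) \<longlongrightarrow> cdf std_normal_distribution z) at_top"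
proof -
  define m where "m t = nat \<lfloor>c * t\<rfloor>" for t
  define P where "P n \<omega> = (\<Sum>i<n. Y i \<omega>)" for n \<omega>
  have rv [measurable]: "random_variable borel (Y n)" for n
    using ind by (auto simp: indep_vars_def)
  have sqn: "integrable M (\<lambda>\<omega>. (Y n \<omega>)\<^sup>2)" for n
    using sq identically_distributed(1)[OF rv rv law, of "\<lambda>x. x\<^sup>2" n] by simp
  have meann: "expectation (Y n) = 0" for n
    using mean identically_distributed(2)[OF rv rv law, of "\<lambda>x. x" n] by simp
  have sn: "expectation (\<lambda>\<omega>. (Y n \<omega>)\<^sup>2) = s" for n
    using s identically_distributed(2)[OF rv rv law, of "\<lambda>x. x\<^sup>2" n] by simp
  have P_rv [measurable]: "random_variable borel (P n)" for n
    unfolding P_def by measurable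
  have P_sq: "integrable M (\<lambda>\<omega>. (P n \<omega>)\<^sup>2)" "expectation (\<lambda>\<omega>. (P n \<omega>)\<^sup>2) = real n * s" for n
    using second_moment_sum_indep[of "{..<n}" Y] indep_vars_subset[OF ind] sqn meann sn
    by (simp_all add: P_def)
  have block: "prob {\<omega> \<in> space M. \<exists>k\<le>n. \<epsilon> \<le> \<bar>P (a + k) \<omega> - P a \<omega>\<bar>} \<le> real n * s / \<epsilon>\<^sup>2" if "0 < \<epsilon>" for a n \<epsilon>
  proof -
    have "indep_vars (\<lambda>_. borel) (\<lambda>i. Y (a + i)) {..<n}"
      by (rule indep_vars_reindex) (auto intro: indep_vars_subset[OF ind])
    then have "prob {\<omega> \<in> space M. \<exists>k\<le>n. \<epsilon> \<le> \<bar>\<Sum>i<k. Y (a + i) \<omega>\<bar>} \<le> (\<Sum>i<n. expectation (\<lambda>\<omega>. (Y (a + i) \<omega>)\<^sup>2)) / \<epsilon>\<^sup>2"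
      by (rule Kolmogorov_maximal_inequality) (use sqn meann that in auto)
    moreover have "P (a + k) \<omega> - P a \<omega> = (\<Sum>i<k. Y (a + i) \<omega>)" for k \<omega>
      unfolding P_def by (induction k) auto
    ultimately show ?thesis
      by (simp add: sn)
  qed
  have m_lim: "filterlim m sequentially at_top"
    unfolding m_def
    by (intro filterlim_compose[OF filterlim_nat_sequentially] filterlim_compose[OF filterlim_floor_sequentially] filterlim_tendsto_pos_mult_at_top[OF tendsto_const c] filterlim_ident)
  have m_bounds: "real (m t) \<le> c * t" "c * t < real (m t) + 1" if "0 \<le> t" for t
    using that c unfolding m_def by simp_all
  define U where "U t \<omega> = P (m t) \<omega> / sqrt (real (m t) * s)" for t \<omega>
  have U_lim: "((\<lambda>t. prob {\<omega> \<in> space M. U t \<omega> \<le> x}) \<longlongrightarrow> cdf std_normal_distribution x) at_top" for x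
    unfolding U_def P_def
    by (rule filterlim_compose[OF cdf_normalized_sums_tendsto(1)[OF ind law sq mean s] m_lim])
  have close: "((\<lambda>t. prob {\<omega> \<in> space M. \<epsilon> * sqrt t \<le> \<bar>F t \<omega> - P (m t) \<omega>\<bar>}) \<longlongrightarrow> 0) at_top" if \<epsilon>: "0 < \<epsilon>" for \<epsilon>
  proof (rule tendstoI)
    fix \<eta> :: real assume \<eta>: "0 < \<eta>"
    \<comment> \<open>The maximal inequality below contributes \<open>32 * s * \<delta> / \<epsilon>\<^sup>2\<close>, up to a vanishing term; this
      choice makes it a quarter of \<open>\<eta>\<close>.\<close>
    define \<delta> where "\<delta> = \<eta> * \<epsilon>\<^sup>2 / (128 * s)"
    have \<delta>: "0 < \<delta>"
      using \<eta> \<epsilon> s by (simp add: \<delta>_def)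
    define K where "K t = nat \<lceil>\<delta> * t\<rceil> + 1" for t
    \<comment> \<open>If \<open>F\<close> is far from the sum up to \<open>m t\<close>, then \<open>N\<close> is far from its mean, or the partial sums
      oscillate within the block \<open>m t - K t, ..., m t + K t\<close>, or a remainder with index in
      that range or below is large. Both \<open>N t\<close> and \<open>m t\<close> are compared with the left end of the block,
      at a cost of \<open>\<epsilon> / 4\<close> each, which leaves \<open>\<epsilon> / 2\<close> for the remainder.\<close>
    let ?N = "\<lambda>t. {\<omega> \<in> space M. \<delta> * t \<le> \<bar>real (N t \<omega>) - c * t\<bar>}"
    let ?P = "\<lambda>t. {\<omega> \<in> space M. \<exists>k\<le>2 * K t. \<epsilon> / 4 * sqrt t \<le> \<bar>P (m t - K t + k) \<omega> - P (m t - K t) \<omega>\<bar>}"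
    let ?W = "\<lambda>n t. {\<omega> \<in> space M. \<epsilon> / 2 * sqrt t \<le> W n \<omega>}"
    let ?b = "\<lambda>t. prob (?N t) + (32 * s * \<delta> / \<epsilon>\<^sup>2 + 64 * s / \<epsilon>\<^sup>2 * inverse t) + (c + \<delta> + 3) * (t * prob (?W 0 t))"
    have "(?b \<longlongrightarrow> 0 + (32 * s * \<delta> / \<epsilon>\<^sup>2 + 64 * s / \<epsilon>\<^sup>2 * 0) + (c + \<delta> + 3) * 0) at_top"
      using \<epsilon> by (intro tendsto_add tendsto_mult tendsto_const N_lim \<delta> tail_prob_square_integrable W W_sq tendsto_inverse_0_at_top filterlim_ident) auto
    moreover have "32 * s * \<delta> / \<epsilon>\<^sup>2 < \<eta>"
      using \<eta> \<epsilon> s by (simp add: \<delta>_def)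
    ultimately have ev: "\<forall>\<^sub>F t in at_top. ?b t < \<eta>"
      by (intro order_tendstoD(2)) auto
    have le: "prob {\<omega> \<in> space M. \<epsilon> * sqrt t \<le> \<bar>F t \<omega> - P (m t) \<omega>\<bar>} \<le> ?b t" if t: "1 \<le> t" for t
    proof -
      have bnd: "AE \<omega> in M. \<bar>F t \<omega> - P (N t \<omega>) \<omega>\<bar> \<le> W (N t \<omega>) \<omega>"
        using bound[of t] t by (simp add: P_def)
      have K: "\<delta> * t + 1 \<le> real (K t)" "real (K t) \<le> \<delta> * t + 2"
        using \<delta> t unfolding K_def by (simp_all, linarith?)
      have mt: "real (m t) \<le> c * t" "c * t < real (m t) + 1"
        using m_bounds[of t] t by auto
      have W_prob: "prob (?W n t) = prob (?W 0 t)" for n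
      proof -
        have "prob (?W n t) = measure (distr M borel (W n)) {\<epsilon> / 2 * sqrt t..}" for n
          by (subst measure_distr) (auto intro!: arg_cong[where f=prob])
        then show ?thesis
          by (simp only: W_law[of n])
      qed
      have "prob {\<omega> \<in> space M. \<epsilon> * sqrt t \<le> \<bar>F t \<omega> - P (m t) \<omega>\<bar>} \<le> prob (?N t \<union> ?P t \<union> (\<Union>n\<in>{..m t + K t}. ?W n t))"
      proof (rule finite_measure_mono_AE)
        show "AE \<omega> in M. \<omega> \<in> {\<omega> \<in> space M. \<epsilon> * sqrt t \<le> \<bar>F t \<omega> - P (m t) \<omega>\<bar>} \<longrightarrow>
            \<omega> \<in> ?N t \<union> ?P t \<union> (\<Union>n\<in>{..m t + K t}. ?W n t)"
          using bnd
        proof eventually_elim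
          case (elim \<omega>)
          show ?case
          proof (rule impI, rule ccontr)
            assume \<omega>: "\<omega> \<in> {\<omega> \<in> space M. \<epsilon> * sqrt t \<le> \<bar>F t \<omega> - P (m t) \<omega>\<bar>}"
              and not: "\<omega> \<notin> ?N t \<union> ?P t \<union> (\<Union>n\<in>{..m t + K t}. ?W n t)"
            have "real (N t \<omega>) < c * t + \<delta> * t" "c * t - \<delta> * t < real (N t \<omega>)"
              using not \<omega> by auto
            then have "real (N t \<omega>) < real (m t) + real (K t)" "real (m t) < real (N t \<omega>) + real (K t)"
              using K mt by linarith+
            then have N_bounds: "m t - K t \<le> N t \<omega>" "N t \<omega> \<le> m t + K t"
              by linarith+
            have close: "\<bar>P n \<omega> - P (m t - K t) \<omega>\<bar> < \<epsilon> / 4 * sqrt t" if "m t - K t \<le> n" "n \<le> m t + K t" for n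
            proof -
              have "n = m t - K t + (n - (m t - K t))" "n - (m t - K t) \<le> 2 * K t"
                using that by auto
              then show ?thesis
                using not \<omega> by (metis (no_types, lifting) UnI1 UnI2 mem_Collect_eq not_le)
            qed
            have "\<bar>F t \<omega> - P (N t \<omega>) \<omega>\<bar> < \<epsilon> / 2 * sqrt t"
              using elim t not \<omega> N_bounds by force
            moreover have "\<bar>w - z\<bar> < e" if "\<bar>w - x\<bar> < e / 2" "\<bar>x - y\<bar> < e / 4" "\<bar>z - y\<bar> < e / 4" for w x y z e :: real
              using that by linarith
            ultimately have "\<bar>F t \<omega> - P (m t) \<omega>\<bar> < \<epsilon> * sqrt t"
              using close[OF N_bounds] close[of "m t"] by (simp add: mult.commute)
            then show False
              using \<omega> by auto
          qed
        qed
      qed measurable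
      also have "\<dots> \<le> prob (?N t) + prob (?P t) + prob (\<Union>n\<in>{..m t + K t}. ?W n t)"
        by (intro order_trans[OF measure_Un_le] add_right_mono measure_Un_le) measurable
      finally have split: "prob {\<omega> \<in> space M. \<epsilon> * sqrt t \<le> \<bar>F t \<omega> - P (m t) \<omega>\<bar>} \<le>
          prob (?N t) + prob (?P t) + prob (\<Union>n\<in>{..m t + K t}. ?W n t)" .
      have "prob (?P t) \<le> real (2 * K t) * s / (\<epsilon> / 4 * sqrt t)\<^sup>2"
        using \<epsilon> t by (intro block) auto
      also have "\<dots> \<le> 2 * (\<delta> * t + 2) * s / (\<epsilon> / 4 * sqrt t)\<^sup>2"
        using K s by (intro divide_right_mono mult_right_mono) auto
      also have "\<dots> = 32 * s * \<delta> / \<epsilon>\<^sup>2 + 64 * s / \<epsilon>\<^sup>2 * inverse t"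
      proof -
        have "(\<epsilon> / 4 * sqrt t)\<^sup>2 = \<epsilon>\<^sup>2 * t / 16"
          using t by (simp add: power_mult_distrib power_divide)
        then show ?thesis
          using t \<epsilon> by (simp add: divide_simps) (simp add: algebra_simps)
      qed
      finally have P_bound: "prob (?P t) \<le> 32 * s * \<delta> / \<epsilon>\<^sup>2 + 64 * s / \<epsilon>\<^sup>2 * inverse t" .
      have "prob (\<Union>n\<in>{..m t + K t}. ?W n t) \<le> (\<Sum>n\<in>{..m t + K t}. prob (?W n t))"
        by (intro finite_measure_subadditive_finite) auto
      also have "\<dots> = (\<Sum>n\<in>{..m t + K t}. prob (?W 0 t))"
        by (rule sum.cong[OF refl]) (rule W_prob)
      also have "\<dots> = real (m t + K t + 1) * prob (?W 0 t)"
        by simp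
      also have "\<dots> \<le> ((c + \<delta> + 3) * t) * prob (?W 0 t)"
      proof (rule mult_right_mono)
        have "real (m t + K t + 1) \<le> c * t + \<delta> * t + 3"
          using K mt by simp
        also have "\<dots> \<le> (c + \<delta> + 3) * t"
          using t by (simp add: algebra_simps)
        finally show "real (m t + K t + 1) \<le> (c + \<delta> + 3) * t" .
      qed auto
      finally have "prob (\<Union>n\<in>{..m t + K t}. ?W n t) \<le> (c + \<delta> + 3) * (t * prob (?W 0 t))"
        by (simp only: mult.assoc)
      with split P_bound show ?thesis
        by linarith
    qed
    from ev show "\<forall>\<^sub>F t in at_top. dist (prob {\<omega> \<in> space M. \<epsilon> * sqrt t \<le> \<bar>F t \<omega> - P (m t) \<omega>\<bar>}) 0 < \<eta>"
    proof (rule eventually_elim2[OF _ eventually_ge_at_top[of 1]])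
      fix t :: real assume b: "?b t < \<eta>" and t: "1 \<le> t"
      from order_le_less_trans[OF le[OF t] b] have "prob {\<omega> \<in> space M. \<epsilon> * sqrt t \<le> \<bar>F t \<omega> - P (m t) \<omega>\<bar>} < \<eta>"
        .
      then show "dist (prob {\<omega> \<in> space M. \<epsilon> * sqrt t \<le> \<bar>F t \<omega> - P (m t) \<omega>\<bar>}) 0 < \<eta>"
        by simp
    qed
  qed
  \<comment> \<open>The norming \<open>sqrt (c * s * t)\<close> may replace \<open>sqrt (m t * s)\<close>: the two differ by a factor tending to
    1, and \<open>U t\<close> has second moment 1 once \<open>m t\<close> is positive.\<close>
  have scale: "((\<lambda>t. prob {\<omega> \<in> space M. \<epsilon> \<le> \<bar>P (m t) \<omega> / sqrt (c * s * t) - U t \<omega>\<bar>}) \<longlongrightarrow> 0) at_top" if \<epsilon>: "0 < \<epsilon>" for \<epsilon>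
  proof -
    have "((\<lambda>t. real (m t) / (c * t)) \<longlongrightarrow> 1) at_top"
    proof (rule tendsto_sandwich[OF _ _ _ tendsto_const])
      have "((\<lambda>t. 1 - inverse c * inverse t) \<longlongrightarrow> 1 - inverse c * 0) at_top"
        by (intro tendsto_intros tendsto_inverse_0_at_top filterlim_ident)
      then show "((\<lambda>t. 1 - inverse c * inverse t) \<longlongrightarrow> 1) at_top"
        by simp
      show "\<forall>\<^sub>F t in at_top. real (m t) / (c * t) \<le> 1"
        using eventually_gt_at_top[of 0]
      proof eventually_elim
        case (elim t)
        then show ?case
          using m_bounds(1)[of t] c by (simp add: field_simps)
      qed
      show "\<forall>\<^sub>F t in at_top. 1 - inverse c * inverse t \<le> real (m t) / (c * t)"
        using eventually_gt_at_top[of 0]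
      proof eventually_elim
        case (elim t)
        then have "1 - inverse c * inverse t = (c * t - 1) / (c * t)"
          using c by (simp add: field_simps)
        also have "\<dots> \<le> real (m t) / (c * t)"
          using m_bounds(2)[of t] c elim by (intro divide_right_mono) auto
        finally show ?case .
      qed
    qed
    then have "((\<lambda>t. (sqrt (real (m t) / (c * t)) - 1)\<^sup>2 / \<epsilon>\<^sup>2) \<longlongrightarrow> (sqrt 1 - 1)\<^sup>2 / \<epsilon>\<^sup>2) at_top"
      using \<epsilon> by (intro tendsto_intros) auto
    then have lim: "((\<lambda>t. (sqrt (real (m t) / (c * t)) - 1)\<^sup>2 / \<epsilon>\<^sup>2) \<longlongrightarrow> 0) at_top"
      by simp
    have le: "prob {\<omega> \<in> space M. \<epsilon> \<le> \<bar>P (m t) \<omega> / sqrt (c * s * t) - U t \<omega>\<bar>} \<le> (sqrt (real (m t) / (c * t)) - 1)\<^sup>2 / \<epsilon>\<^sup>2"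
      if t: "0 < t" "0 < m t" for t
    proof -
      define q where "q = 1 / sqrt (c * s * t) - 1 / sqrt (real (m t) * s)"
      have U: "P (m t) \<omega> / sqrt (c * s * t) - U t \<omega> = q * P (m t) \<omega>" for \<omega>
        by (simp add: U_def q_def algebra_simps)
      have "prob {\<omega> \<in> space M. \<epsilon> \<le> \<bar>q * P (m t) \<omega>\<bar>} \<le> expectation (\<lambda>\<omega>. (q * P (m t) \<omega>)\<^sup>2) / \<epsilon>\<^sup>2"
        using P_sq(1) \<epsilon> by (intro prob_abs_ge_le_second_moment) (auto simp: power_mult_distrib)
      also have "expectation (\<lambda>\<omega>. (q * P (m t) \<omega>)\<^sup>2) = (q * sqrt (real (m t) * s))\<^sup>2"
        using P_sq(2) s by (simp add: power_mult_distrib)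
      also have "q * sqrt (real (m t) * s) = sqrt (real (m t) / (c * t)) - 1"
        using t s c by (simp add: q_def real_sqrt_mult real_sqrt_divide field_simps)
      finally show ?thesis
        unfolding U .
    qed
    have "\<forall>\<^sub>F t in at_top. 0 < m t"
      by (rule filterlim_iff[THEN iffD1, OF m_lim, rule_format, OF eventually_gt_at_top])
    with eventually_gt_at_top[of 0]
    have "\<forall>\<^sub>F t in at_top. prob {\<omega> \<in> space M. \<epsilon> \<le> \<bar>P (m t) \<omega> / sqrt (c * s * t) - U t \<omega>\<bar>} \<le>
        (sqrt (real (m t) / (c * t)) - 1)\<^sup>2 / \<epsilon>\<^sup>2"
      by eventually_elim (rule le)
    then show ?thesis
      by (intro tendsto_sandwich[OF _ _ tendsto_const lim]) auto
  qed
  show ?thesis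
  proof (rule Slutsky_cdf[OF _ _ U_lim])
    show "random_variable borel (U t)" "random_variable borel (\<lambda>\<omega>. F t \<omega> / sqrt (c * s * t))" for t
      unfolding U_def by measurable
    show "isCont (cdf std_normal_distribution) z"
      by (rule cdf_normalized_sums_tendsto(2)[OF ind law sq mean s])
    fix \<epsilon> :: real assume \<epsilon>: "0 < \<epsilon>"
    have [measurable]: "random_variable borel (U t)" for t
      unfolding U_def by measurable
    let ?A = "\<lambda>t. {\<omega> \<in> space M. \<epsilon> / 2 * sqrt (c * s) * sqrt t \<le> \<bar>F t \<omega> - P (m t) \<omega>\<bar>}"
    let ?B = "\<lambda>t. {\<omega> \<in> space M. \<epsilon> / 2 \<le> \<bar>P (m t) \<omega> / sqrt (c * s * t) - U t \<omega>\<bar>}"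
    have "((\<lambda>t. prob (?A t) + prob (?B t)) \<longlongrightarrow> 0 + 0) at_top"
      using \<epsilon> c s by (intro tendsto_add close scale) auto
    then have lim: "((\<lambda>t. prob (?A t) + prob (?B t)) \<longlongrightarrow> 0) at_top"
      by simp
    have le: "prob {\<omega> \<in> space M. \<epsilon> \<le> \<bar>F t \<omega> / sqrt (c * s * t) - U t \<omega>\<bar>} \<le> prob (?A t) + prob (?B t)"
      if t: "0 < t" for t
    proof -
      have pos: "0 < sqrt (c * s * t)"
        using c s t by simp
      have "prob {\<omega> \<in> space M. \<epsilon> \<le> \<bar>F t \<omega> / sqrt (c * s * t) - U t \<omega>\<bar>} \<le> prob (?A t \<union> ?B t)"
      proof (rule finite_measure_mono)
        show "{\<omega> \<in> space M. \<epsilon> \<le> \<bar>F t \<omega> / sqrt (c * s * t) - U t \<omega>\<bar>} \<subseteq> ?A t \<union> ?B t"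
        proof
          fix \<omega> assume \<omega>: "\<omega> \<in> {\<omega> \<in> space M. \<epsilon> \<le> \<bar>F t \<omega> / sqrt (c * s * t) - U t \<omega>\<bar>}"
          have big: "\<epsilon> / 2 \<le> \<bar>(F t \<omega> - P (m t) \<omega>) / sqrt (c * s * t)\<bar>" if "\<omega> \<notin> ?B t"
          proof -
            have "\<bar>x - y\<bar> \<ge> \<epsilon> / 2" if "\<epsilon> \<le> \<bar>x - u\<bar>" "\<not> \<epsilon> / 2 \<le> \<bar>y - u\<bar>" for x y u :: real
              using that by linarith
            then show ?thesis
              using \<omega> that unfolding diff_divide_distrib by blast
          qed
          show "\<omega> \<in> ?A t \<union> ?B t"
          proof (cases "\<omega> \<in> ?B t")
            case False
            have "\<epsilon> / 2 \<le> \<bar>F t \<omega> - P (m t) \<omega>\<bar> / sqrt (c * s * t)"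
              using big[OF False] by (simp only: abs_divide abs_of_pos[OF pos])
            then have "\<epsilon> / 2 * sqrt (c * s * t) \<le> \<bar>F t \<omega> - P (m t) \<omega>\<bar>"
              by (simp only: pos_le_divide_eq[OF pos])
            then have "\<epsilon> / 2 * (sqrt (c * s) * sqrt t) \<le> \<bar>F t \<omega> - P (m t) \<omega>\<bar>"
              by (simp only: real_sqrt_mult[of "c * s" t])
            then show ?thesis
              using \<omega> by (simp only: mult.assoc) blast
          qed blast
        qed
      qed measurable
      also have "\<dots> \<le> prob (?A t) + prob (?B t)"
        by (rule measure_Un_le) measurable
      finally show ?thesis .
    qed
    show "((\<lambda>t. prob {\<omega> \<in> space M. \<epsilon> \<le> \<bar>F t \<omega> / sqrt (c * s * t) - U t \<omega>\<bar>}) \<longlongrightarrow> 0) at_top"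
    proof (rule tendsto_sandwich[OF _ _ tendsto_const lim])
      show "\<forall>\<^sub>F t in at_top. prob {\<omega> \<in> space M. \<epsilon> \<le> \<bar>F t \<omega> / sqrt (c * s * t) - U t \<omega>\<bar>} \<le> prob (?A t) + prob (?B t)"
        using eventually_gt_at_top[of 0] by eventually_elim (rule le)
    qed simp
  qed
qed

section \<open>The number of resets\<close>

lemma reset_time_0 [simp]: "reset_time S 0 \<omega> = 0"
  by (simp add: reset_time_def)

lemma reset_time_Suc: "reset_time S (Suc n) \<omega> = reset_time S n \<omega> + S (Suc n) \<omega>"
  by (simp add: reset_time_def)

lemma reset_time_mono:
  assumes "\<And>n. 1 \<le> n \<Longrightarrow> 0 \<le> S n \<omega>" and "m \<le> n"
  shows "reset_time S m \<omega> \<le> reset_time S n \<omega>"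
  using assms by (auto simp: reset_time_def intro!: sum_mono2)

lemma num_resets_eqI:
  assumes nonneg: "\<And>n. 1 \<le> n \<Longrightarrow> 0 \<le> S n \<omega>"
    and "reset_time S n \<omega> \<le> t" "t < reset_time S (Suc n) \<omega>"
  shows "num_resets S t \<omega> = n"
  unfolding num_resets_def
proof (rule cSup_eq_maximum)
  show "n \<in> {n. reset_time S n \<omega> \<le> t}"
    using assms by simp
  fix k assume "k \<in> {n. reset_time S n \<omega> \<le> t}"
  then show "k \<le> n"
    using assms reset_time_mono[of S \<omega> "Suc n" k, OF nonneg] by (cases "k \<le> n") auto
qed

lemma num_resets_bounds:
  assumes nonneg: "\<And>n. 1 \<le> n \<Longrightarrow> 0 \<le> S n \<omega>" and fin: "finite {n. reset_time S n \<omega> \<le> t}" and t: "0 \<le> t"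
  shows "reset_time S (num_resets S t \<omega>) \<omega> \<le> t" "t < reset_time S (Suc (num_resets S t \<omega>)) \<omega>"
proof -
  let ?A = "{n. reset_time S n \<omega> \<le> t}"
  have ne: "?A \<noteq> {}"
    using t by (auto intro!: exI[of _ 0])
  have N: "num_resets S t \<omega> = Max ?A"
    using ne by (simp only: num_resets_def Sup_nat_def if_False)
  show "reset_time S (num_resets S t \<omega>) \<omega> \<le> t"
    using Max_in[OF fin ne] by (simp add: N)
  show "t < reset_time S (Suc (num_resets S t \<omega>)) \<omega>"
    using Max_ge[OF fin, of "Suc (Max ?A)"] by (fastforce simp: N not_le)
qed

text \<open>
  Shows that the elapsed time since the last reset is nonnegative whatever value \<open>num_resets\<close> takes
  when infinitely many resets have occurred.
\<close>

lemma reset_time_le_if_infinite: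
  assumes nonneg: "\<And>n. 1 \<le> n \<Longrightarrow> 0 \<le> S n \<omega>" and inf: "infinite {n. reset_time S n \<omega> \<le> t}"
  shows "reset_time S n \<omega> \<le> t"
proof -
  obtain k where "n \<le> k" "reset_time S k \<omega> \<le> t"
    using inf by (auto simp: infinite_nat_iff_unbounded_le)
  then show ?thesis
    using reset_time_mono[of S \<omega> n k, OF nonneg] by simp
qed

lemma measurable_num_resets:
  assumes [measurable]: "\<And>n. 1 \<le> n \<Longrightarrow> S n \<in> borel_measurable M"
  shows "(\<lambda>(t, \<omega>). num_resets S t \<omega>) \<in> measurable (borel \<Otimes>\<^sub>M M) (count_space UNIV)"
  unfolding num_resets_def reset_time_def by measurable

context prob_space
begin

lemma reset_time_Chebyshev:
  fixes S :: "nat \<Rightarrow> 'a \<Rightarrow> real"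
  assumes ind: "indep_vars (\<lambda>_. borel) S {1..}"
    and law: "\<And>n. 1 \<le> n \<Longrightarrow> distr M borel (S n) = distr M borel (S 1)"
    and sq: "integrable M (\<lambda>\<omega>. (S 1 \<omega>)\<^sup>2)"
    and a: "0 < a"
  shows "prob {\<omega> \<in> space M. a \<le> \<bar>reset_time S n \<omega> - real n * expectation (S 1)\<bar>} \<le> real n * variance (S 1) / a\<^sup>2"
proof -
  have rv [measurable]: "random_variable borel (S n)" if "1 \<le> n" for n
    using ind that by (auto simp: indep_vars_def)
  let ?X = "\<lambda>i \<omega>. S i \<omega> - expectation (S 1)"
  have int: "integrable M (S 1)"
    by (rule square_integrable_imp_integrable[OF rv sq]) simp
  have ind': "indep_vars (\<lambda>_. borel) ?X {1..n}"
    by (rule indep_vars_compose2[where X=S and Y="\<lambda>_ x. x - expectation (S 1)", OF indep_vars_subset[OF ind]]) auto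
  have sq1: "integrable M (\<lambda>\<omega>. (?X 1 \<omega>)\<^sup>2)"
    using int sq by (simp add: power2_diff)
  have sqn: "integrable M (\<lambda>\<omega>. (?X i \<omega>)\<^sup>2)" "expectation (?X i) = 0" "expectation (\<lambda>\<omega>. (?X i \<omega>)\<^sup>2) = variance (S 1)" if "1 \<le> i" for i
  proof -
    note same = identically_distributed[OF rv[OF that] rv[OF order_refl] law[OF that]]
    show "integrable M (\<lambda>\<omega>. (?X i \<omega>)\<^sup>2)"
      using same(1)[of "\<lambda>x. (x - expectation (S 1))\<^sup>2"] sq1 by simp
    show "expectation (?X i) = 0"
      using same(2)[of "\<lambda>x. x - expectation (S 1)"] int by (simp add: prob_space)
    show "expectation (\<lambda>\<omega>. (?X i \<omega>)\<^sup>2) = variance (S 1)"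
      using same(2)[of "\<lambda>x. (x - expectation (S 1))\<^sup>2"] by simp
  qed
  have "prob {\<omega> \<in> space M. a \<le> \<bar>\<Sum>i\<in>{1..n}. ?X i \<omega>\<bar>} \<le> expectation (\<lambda>\<omega>. (\<Sum>i\<in>{1..n}. ?X i \<omega>)\<^sup>2) / a\<^sup>2"
    using sqn ind' by (intro prob_abs_ge_le_second_moment a second_moment_sum_indep(1)) auto
  also have "expectation (\<lambda>\<omega>. (\<Sum>i\<in>{1..n}. ?X i \<omega>)\<^sup>2) = real n * variance (S 1)"
  proof (subst second_moment_sum_indep(2)[OF _ ind'])
    have "(\<Sum>i\<in>{1..n}. expectation (\<lambda>\<omega>. (?X i \<omega>)\<^sup>2)) = (\<Sum>i\<in>{1..n}. variance (S 1))"
      by (rule sum.cong[OF refl], rule sqn(3)) simp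
    then show "(\<Sum>i\<in>{1..n}. expectation (\<lambda>\<omega>. (?X i \<omega>)\<^sup>2)) = real n * variance (S 1)"
      by simp
  qed (use sqn(1,2) in auto)
  finally show ?thesis
    by (simp add: reset_time_def sum_subtractf)
qed

text \<open>
  The event that all reset times are bounded by \<open>t\<close> lies in each event that a single one is. By
  Chebyshev's inequality the probabilities of the latter tend to 0.
\<close>

lemma AE_finitely_many_resets:
  fixes S :: "nat \<Rightarrow> 'a \<Rightarrow> real"
  assumes nonneg: "\<And>n \<omega>. 1 \<le> n \<Longrightarrow> \<omega> \<in> space M \<Longrightarrow> 0 \<le> S n \<omega>"
    and ind: "indep_vars (\<lambda>_. borel) S {1..}"
    and law: "\<And>n. 1 \<le> n \<Longrightarrow> distr M borel (S n) = distr M borel (S 1)"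
    and sq: "integrable M (\<lambda>\<omega>. (S 1 \<omega>)\<^sup>2)"
    and pos: "0 < expectation (S 1)"
  shows "AE \<omega> in M. finite {n. reset_time S n \<omega> \<le> t}"
proof -
  have rv [measurable]: "random_variable borel (S n)" if "1 \<le> n" for n
    using ind that by (auto simp: indep_vars_def)
  have T [measurable]: "random_variable borel (reset_time S n)" for n
    unfolding reset_time_def by measurable
  let ?e = "expectation (S 1)"
  let ?A = "{\<omega> \<in> space M. \<forall>n. reset_time S n \<omega> \<le> t}"
  have le: "prob ?A \<le> 4 * variance (S 1) / ?e\<^sup>2 * inverse (real n)" if n: "2 * \<bar>t\<bar> / ?e + 1 \<le> real n" for n
  proof -
    have "0 < real n"
      using n pos by (smt (verit) divide_nonneg_pos)
    have "2 * \<bar>t\<bar> / ?e \<le> real n"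
      using n by simp
    then have tn: "2 * \<bar>t\<bar> \<le> real n * ?e"
      using pos by (simp add: pos_divide_le_eq)
    have "prob ?A \<le> prob {\<omega> \<in> space M. real n * ?e / 2 \<le> \<bar>reset_time S n \<omega> - real n * ?e\<bar>}"
    proof (rule finite_measure_mono)
      show "?A \<subseteq> {\<omega> \<in> space M. real n * ?e / 2 \<le> \<bar>reset_time S n \<omega> - real n * ?e\<bar>}"
      proof
        fix \<omega> assume "\<omega> \<in> ?A"
        then have "\<omega> \<in> space M" "reset_time S n \<omega> \<le> t"
          by auto
        then show "\<omega> \<in> {\<omega> \<in> space M. real n * ?e / 2 \<le> \<bar>reset_time S n \<omega> - real n * ?e\<bar>}"
          using tn by (simp add: abs_le_iff)
      qed
    qed measurable
    also have "\<dots> \<le> real n * variance (S 1) / (real n * ?e / 2)\<^sup>2"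
      using \<open>0 < real n\<close> pos by (intro reset_time_Chebyshev[OF ind law sq]) auto
    also have "\<dots> = 4 * variance (S 1) / ?e\<^sup>2 * inverse (real n)"
      using \<open>0 < real n\<close> pos by (simp add: power2_eq_square field_simps)
    finally show ?thesis .
  qed
  have "(\<lambda>n. 4 * variance (S 1) / ?e\<^sup>2 * inverse (real n)) \<longlonglongrightarrow> 4 * variance (S 1) / ?e\<^sup>2 * 0"
    by (intro tendsto_mult tendsto_const lim_inverse_n)
  moreover have "\<forall>\<^sub>F n in sequentially. prob ?A \<le> 4 * variance (S 1) / ?e\<^sup>2 * inverse (real n)"
    using filterlim_at_top[THEN iffD1, OF filterlim_real_sequentially, rule_format, of "2 * \<bar>t\<bar> / ?e + 1"]
    by eventually_elim (rule le)
  ultimately have "prob ?A \<le> 0"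
    using tendsto_lowerbound[of "\<lambda>n. 4 * variance (S 1) / ?e\<^sup>2 * inverse (real n)" _ sequentially "prob ?A"] by simp
  then have "prob ?A = 0"
    using measure_nonneg[of M ?A] by linarith
  then have "AE \<omega> in M. \<omega> \<notin> ?A"
    by (intro AE_not_in) (simp add: null_sets_def emeasure_eq_measure)
  then show ?thesis
    using AE_space
  proof eventually_elim
    case (elim \<omega>)
    then show ?case
      using reset_time_le_if_infinite[of S \<omega> t] nonneg by auto
  qed
qed

text \<open>
  At least \<open>n\<close> resets by time \<open>t\<close> mean that the \<open>n\<close>-th reset time is at most \<open>t\<close>, and fewer mean that
  it exceeds \<open>t\<close>. For \<open>n\<close> off \<open>t / E(S 1)\<close> by about \<open>\<delta> * t\<close> either event is a deviation of
  order \<open>t\<close> of a sum whose variance is of order \<open>t\<close>.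
\<close>

lemma num_resets_weak_law:
  fixes S :: "nat \<Rightarrow> 'a \<Rightarrow> real"
  assumes nonneg: "\<And>n \<omega>. 1 \<le> n \<Longrightarrow> \<omega> \<in> space M \<Longrightarrow> 0 \<le> S n \<omega>"
    and ind: "indep_vars (\<lambda>_. borel) S {1..}"
    and law: "\<And>n. 1 \<le> n \<Longrightarrow> distr M borel (S n) = distr M borel (S 1)"
    and sq: "integrable M (\<lambda>\<omega>. (S 1 \<omega>)\<^sup>2)"
    and pos: "0 < expectation (S 1)"
    and \<delta>: "0 < \<delta>"
  shows "((\<lambda>t. prob {\<omega> \<in> space M. \<delta> * t \<le> \<bar>real (num_resets S t \<omega>) - 1 / expectation (S 1) * t\<bar>}) \<longlongrightarrow> 0) at_top"
proof -
  have rv [measurable]: "random_variable borel (S n)" if "1 \<le> n" for n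
    using ind that by (auto simp: indep_vars_def)
  have T [measurable]: "random_variable borel (reset_time S n)" for n
    unfolding reset_time_def by measurable
  define e where "e = expectation (S 1)"
  define c where "c = 1 / e"
  have e: "0 < e" and c: "0 < c" and ce: "c * e = 1"
    using pos by (auto simp: e_def c_def)
  \<comment> \<open>Half of the shift \<open>\<delta> * e * t\<close> of the mean; the other half absorbs the rounding of the index.\<close>
  define a where "a t = \<delta> * e * t / 2" for t
  let ?C = "\<lambda>n t. {\<omega> \<in> space M. a t \<le> \<bar>reset_time S n \<omega> - real n * e\<bar>}"
  let ?E = "\<lambda>t. {\<omega> \<in> space M. \<delta> * t \<le> \<bar>real (num_resets S t \<omega>) - c * t\<bar>}"
  define \<kappa> where "\<kappa> = (c + \<delta>) * variance (S 1) / (\<delta> * e / 2)\<^sup>2"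
  have le: "prob (?E t) \<le> 2 * \<kappa> * inverse t" if "max (2 / \<delta>) (1 / c) \<le> t" for t
  proof -
    have t: "2 \<le> \<delta> * t" "1 \<le> c * t"
      using that \<delta> c by (simp_all add: field_simps)
    then have t0: "0 < t"
      using c by (smt (verit) mult_nonneg_nonpos)
    define n1 where "n1 = nat \<lfloor>(c + \<delta>) * t\<rfloor>"
    define n2 where "n2 = nat \<lfloor>(c - \<delta>) * t\<rfloor> + 1"
    have n1: "real n1 \<le> (c + \<delta>) * t" "(c + \<delta>) * t - 1 \<le> real n1"
      using c \<delta> t0 unfolding n1_def by (auto simp: of_nat_nat) linarith?
    have n2: "real n2 \<le> (c + \<delta>) * t"
    proof (cases "0 \<le> (c - \<delta>) * t")
      case True
      then have "real n2 \<le> (c - \<delta>) * t + 1"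
        unfolding n2_def by (simp add: of_nat_nat)
      also have "\<dots> \<le> (c + \<delta>) * t"
        using t by (simp add: algebra_simps)
      finally show ?thesis .
    next
      case False
      then show ?thesis
        unfolding n2_def using t by (simp add: algebra_simps)
    qed
    have a_pos: "0 < a t"
      using \<delta> e t0 by (simp add: a_def)
    have cheb: "prob (?C n t) \<le> \<kappa> * inverse t" if "real n \<le> (c + \<delta>) * t" for n
    proof -
      have "prob (?C n t) \<le> real n * variance (S 1) / (a t)\<^sup>2"
        unfolding e_def by (rule reset_time_Chebyshev[OF ind law sq a_pos])
      also have "\<dots> \<le> (c + \<delta>) * t * variance (S 1) / (a t)\<^sup>2"
        using that by (intro divide_right_mono mult_right_mono) (auto intro: integral_nonneg)
      also have "\<dots> = \<kappa> * inverse t"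
        using t0 \<delta> e by (simp add: a_def \<kappa>_def power2_eq_square field_simps)
      finally show ?thesis .
    qed
    have fin: "AE \<omega> in M. finite {n. reset_time S n \<omega> \<le> t}"
      by (rule AE_finitely_many_resets[OF nonneg ind law sq pos])
    have "prob (?E t) \<le> prob (?C n1 t \<union> ?C n2 t)"
    proof (rule finite_measure_mono_AE)
      show "AE \<omega> in M. \<omega> \<in> ?E t \<longrightarrow> \<omega> \<in> ?C n1 t \<union> ?C n2 t"
        using fin AE_space
      proof eventually_elim
        case (elim \<omega>)
        let ?n = "num_resets S t \<omega>"
        have nn: "\<And>n. 1 \<le> n \<Longrightarrow> 0 \<le> S n \<omega>"
          using nonneg elim(2) by auto
        note N = num_resets_bounds[of S \<omega> t, OF nn elim(1)]
        show ?case
        proof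
          assume "\<omega> \<in> ?E t"
          then consider "(c + \<delta>) * t \<le> real ?n" | "real ?n \<le> (c - \<delta>) * t"
            by (auto simp: algebra_simps abs_if split: if_splits)
          then show "\<omega> \<in> ?C n1 t \<union> ?C n2 t"
          proof cases
            case 1
            with n1 have "n1 \<le> ?n"
              by linarith
            then have "reset_time S n1 \<omega> \<le> t"
              using reset_time_mono[of S \<omega> n1 ?n, OF nn] N t0 by linarith
            moreover have "((c + \<delta>) * t - 1) * e \<le> real n1 * e"
              using n1 e by (intro mult_right_mono) auto
            moreover have "((c + \<delta>) * t - 1) * e = (c * e) * t + \<delta> * t * e - e"
              by (simp add: algebra_simps)
            moreover have "2 * e \<le> \<delta> * t * e"
              using t e by (intro mult_right_mono) auto
            moreover have "a t = \<delta> * t * e / 2"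
              by (simp add: a_def)
            ultimately have "a t \<le> \<bar>reset_time S n1 \<omega> - real n1 * e\<bar>"
              unfolding ce by linarith
            then show ?thesis
              using elim by auto
          next
            case 2
            then have nonneg': "0 \<le> (c - \<delta>) * t"
              by linarith
            with 2 have "Suc ?n \<le> n2"
              unfolding n2_def by (simp add: le_nat_floor)
            then have "t \<le> reset_time S n2 \<omega>"
              using reset_time_mono[of S \<omega> "Suc ?n" n2, OF nn] N t0 by linarith
            moreover have "real n2 * e \<le> ((c - \<delta>) * t + 1) * e"
              using nonneg' e unfolding n2_def by (intro mult_right_mono) (auto simp: of_nat_nat)
            moreover have "((c - \<delta>) * t + 1) * e = (c * e) * t - \<delta> * t * e + e"
              by (simp add: algebra_simps)
            moreover have "2 * e \<le> \<delta> * t * e"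
              using t e by (intro mult_right_mono) auto
            moreover have "a t = \<delta> * t * e / 2"
              by (simp add: a_def)
            ultimately have "a t \<le> \<bar>reset_time S n2 \<omega> - real n2 * e\<bar>"
              unfolding ce by linarith
            then show ?thesis
              using elim by auto
          qed
        qed
      qed
    qed measurable
    also have "\<dots> \<le> prob (?C n1 t) + prob (?C n2 t)"
      by (rule measure_Un_le) measurable
    also have "\<dots> \<le> 2 * \<kappa> * inverse t"
      using add_mono[OF cheb[OF n1(1)] cheb[OF n2]] by simp
    finally show ?thesis .
  qed
  have "((\<lambda>t. 2 * \<kappa> * inverse t) \<longlongrightarrow> 2 * \<kappa> * 0) at_top"
    by (intro tendsto_mult tendsto_const tendsto_inverse_0_at_top filterlim_ident)
  then have lim: "((\<lambda>t. 2 * \<kappa> * inverse t) \<longlongrightarrow> 0) at_top"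
    by simp
  have "((\<lambda>t. prob (?E t)) \<longlongrightarrow> 0) at_top"
  proof (rule tendsto_sandwich[OF _ _ tendsto_const lim])
    show "\<forall>\<^sub>F t in at_top. prob (?E t) \<le> 2 * \<kappa> * inverse t"
      using eventually_ge_at_top[of "max (2 / \<delta>) (1 / c)"] by eventually_elim (rule le)
  qed simp
  then show ?thesis
    by (simp only: c_def e_def)
qed

end

section \<open>Cycle integrals as functionals of waiting time and path\<close>

text \<open>
  The equations say that the squared L2-distance of \<open>a\<close> and \<open>b\<close> is 0, in a form that avoids
  subtracting extended-valued functions.
\<close>

lemma AE_eq_if_square_nn_integrals_eq:
  fixes a b :: "'a \<Rightarrow> ennreal"
  assumes a [measurable]: "a \<in> borel_measurable M" and b [measurable]: "b \<in> borel_measurable M"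
    and eq: "(\<integral>\<^sup>+x. a x * a x \<partial>M) = (\<integral>\<^sup>+x. a x * b x \<partial>M)" "(\<integral>\<^sup>+x. b x * b x \<partial>M) = (\<integral>\<^sup>+x. a x * b x \<partial>M)"
    and fin: "(\<integral>\<^sup>+x. a x * b x \<partial>M) < \<infinity>"
  shows "AE x in M. a x = b x"
proof -
  have "AE x in M. a x * a x \<noteq> \<infinity>" "AE x in M. b x * b x \<noteq> \<infinity>"
    using eq fin by (intro nn_integral_noteq_infinite; simp)+
  then have finite: "AE x in M. a x < \<infinity> \<and> b x < \<infinity>"
    by eventually_elim (auto simp: top.not_eq_extremum[symmetric] ennreal_mult_eq_top_iff)
  have square: "2 * (a x * b x) \<le> a x * a x + b x * b x"
    "a x * a x + b x * b x \<le> 2 * (a x * b x) \<Longrightarrow> a x = b x" if "a x < \<infinity>" "b x < \<infinity>" for x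
  proof -
    obtain r q where rq: "0 \<le> r" "0 \<le> q" "a x = ennreal r" "b x = ennreal q"
      using \<open>a x < \<infinity>\<close> \<open>b x < \<infinity>\<close> by (cases "a x"; cases "b x") auto
    have *: "2 * (a x * b x) = ennreal (2 * (r * q))" "a x * a x + b x * b x = ennreal (r * r + q * q)"
      using rq by (simp_all add: ennreal_mult ennreal_plus flip: ennreal_numeral)
    have sq: "r * r + q * q - 2 * (r * q) = (r - q)\<^sup>2"
      by (simp add: power2_eq_square algebra_simps)
    then have "2 * (r * q) \<le> r * r + q * q"
      using zero_le_power2[of "r - q"] by linarith
    then show "2 * (a x * b x) \<le> a x * a x + b x * b x"
      unfolding * by (rule ennreal_leI)
    assume "a x * a x + b x * b x \<le> 2 * (a x * b x)"
    then have "r * r + q * q \<le> 2 * (r * q)"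
      unfolding * using rq by (subst (asm) ennreal_le_iff) auto
    then have "(r - q)\<^sup>2 = 0"
      using sq zero_le_power2[of "r - q"] by linarith
    then show "a x = b x"
      using rq by simp
  qed
  have sum_eq: "(\<integral>\<^sup>+x. a x * a x + b x * b x \<partial>M) = (\<integral>\<^sup>+x. 2 * (a x * b x) \<partial>M)"
    by (simp add: nn_integral_add nn_integral_cmult eq mult_2)
  have "(\<integral>\<^sup>+x. (a x * a x + b x * b x) - 2 * (a x * b x) \<partial>M) =
      (\<integral>\<^sup>+x. a x * a x + b x * b x \<partial>M) - (\<integral>\<^sup>+x. 2 * (a x * b x) \<partial>M)"
  proof (rule nn_integral_diff)
    show "(\<integral>\<^sup>+x. 2 * (a x * b x) \<partial>M) \<noteq> \<infinity>"
      using fin by (simp add: nn_integral_cmult ennreal_mult_eq_top_iff)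
    show "AE x in M. 2 * (a x * b x) \<le> a x * a x + b x * b x"
      using finite by eventually_elim (use square in auto)
  qed measurable
  also have "\<dots> = 0"
    unfolding sum_eq using fin by (simp add: nn_integral_cmult ennreal_mult_eq_top_iff diff_eq_0_iff_ennreal)
  finally have "AE x in M. (a x * a x + b x * b x) - 2 * (a x * b x) = 0"
    by (subst (asm) nn_integral_0_iff_AE) auto
  then show ?thesis
    using finite
  proof eventually_elim
    case (elim x)
    then have "a x * a x + b x * b x \<le> 2 * (a x * b x)"
      by (auto simp: diff_eq_0_iff_ennreal)
    then show ?case
      using square(2)[of x] elim(2) by auto
  qed
qed

text \<open>
  The integral over time of a jointly measurable process need not be measurable with respect to
  the random element \<open>Q i\<close>, of which only the single times \<open>h t\<close> are assumed measurable: the map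
  \<open>(t, x) \<mapsto> h t x\<close> may fail to be measurable. It nevertheless agrees almost surely with a
  functional of \<open>Q i\<close>, and with the same functional for all \<open>i\<close>. This is what turns independence and
  equality of the laws of the \<open>Q i\<close> into the same properties of the integrals.
  
  The functional is the conditional expectation of the integral given \<open>Q j\<close>, obtained as a
  Radon-Nikodym derivative \<open>\<Phi>\<close>. By Tonelli's theorem the expectation of \<open>Z (Q i)\<close> times the integral
  depends on the law of \<open>Q i\<close> only, so \<open>\<Phi>\<close> serves all \<open>i\<close>. Apply this to \<open>Z = h t\<close> and integrate
  over \<open>t\<close>: the integral \<open>A i\<close> satisfies \<open>E(A * A) = E(A * \<Phi>) = E(\<Phi> * \<Phi>)\<close>, whence \<open>A i = \<Phi> (Q i)\<close>
  almost surely. Finiteness of the second moment passes from \<open>j\<close> to every \<open>i\<close>, since \<open>E(\<Phi> * \<Phi>)\<close>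
  depends on the common law only.
\<close>

lemma (in prob_space) time_integral_eq_functional:
  fixes Q :: "'i \<Rightarrow> 'a \<Rightarrow> 'e" and h :: "real \<Rightarrow> 'e \<Rightarrow> ennreal"
  assumes Q: "\<And>i. i \<in> I \<Longrightarrow> Q i \<in> measurable M E"
    and law: "\<And>i. i \<in> I \<Longrightarrow> distr M E (Q i) = distr M E (Q j)" and j: "j \<in> I"
    and h: "\<And>t. h t \<in> borel_measurable E"
    and joint: "\<And>i. i \<in> I \<Longrightarrow> (\<lambda>(t, \<omega>). h t (Q i \<omega>)) \<in> borel_measurable (lborel \<Otimes>\<^sub>M M)"
    and sq: "(\<integral>\<^sup>+\<omega>. (\<integral>\<^sup>+t. h t (Q j \<omega>) \<partial>lborel)\<^sup>2 \<partial>M) < \<infinity>"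
  obtains \<Phi> where "\<Phi> \<in> borel_measurable E"
    and "\<And>i. i \<in> I \<Longrightarrow> AE \<omega> in M. (\<integral>\<^sup>+t. h t (Q i \<omega>) \<partial>lborel) = \<Phi> (Q i \<omega>)"
proof -
  define A where "A i \<omega> = (\<integral>\<^sup>+t. h t (Q i \<omega>) \<partial>lborel)" for i \<omega>
  define L where "L = distr M E (Q j)"
  interpret pair_sigma_finite lborel M ..
  interpret L: prob_space L
    unfolding L_def by (rule prob_space_distr[OF Q[OF j]])
  have sets_L [measurable_cong]: "sets L = sets E"
    by (simp add: L_def)
  have A [measurable]: "A i \<in> borel_measurable M" if "i \<in> I" for i
    unfolding A_def using measurable_pair_swap[OF joint[OF that]]
    by (intro lborel.borel_measurable_nn_integral) (simp add: case_prod_beta')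
  have expect: "(\<integral>\<^sup>+\<omega>. Z (Q i \<omega>) \<partial>M) = (\<integral>\<^sup>+x. Z x \<partial>L)" if "i \<in> I" "Z \<in> borel_measurable E" for i Z
    using nn_integral_distr[OF Q[OF that(1)], of Z] that(2) law[OF that(1)] by (simp add: L_def)
  have Fub: "(\<integral>\<^sup>+\<omega>. Z \<omega> * A i \<omega> \<partial>M) = (\<integral>\<^sup>+t. \<integral>\<^sup>+\<omega>. Z \<omega> * h t (Q i \<omega>) \<partial>M \<partial>lborel)"
    if i: "i \<in> I" and Z: "Z \<in> borel_measurable M" for i Z
  proof -
    have m: "(\<lambda>(t, \<omega>). Z \<omega> * h t (Q i \<omega>)) \<in> borel_measurable (lborel \<Otimes>\<^sub>M M)"
      using measurable_compose[OF measurable_snd Z] joint[OF i] unfolding case_prod_beta'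
      by (intro borel_measurable_times_ennreal) auto
    have "(\<lambda>t. h t (Q i \<omega>)) \<in> borel_measurable lborel" if "\<omega> \<in> space M" for \<omega>
      using measurable_compose[OF measurable_Pair2'[OF that] joint[OF i]] by simp
    then have "(\<integral>\<^sup>+\<omega>. Z \<omega> * A i \<omega> \<partial>M) = (\<integral>\<^sup>+\<omega>. \<integral>\<^sup>+t. Z \<omega> * h t (Q i \<omega>) \<partial>lborel \<partial>M)"
      unfolding A_def by (intro nn_integral_cong) (simp add: nn_integral_cmult)
    also have "\<dots> = (\<integral>\<^sup>+t. \<integral>\<^sup>+\<omega>. Z \<omega> * h t (Q i \<omega>) \<partial>M \<partial>lborel)"
      using Fubini'[OF m] by simp
    finally show ?thesis .
  qed
  define N where "N = distr (density M (A j)) E (Q j)"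
  have Qj: "Q j \<in> measurable (density M (A j)) E"
    using Q[OF j] by simp
  have "absolutely_continuous L N"
    unfolding absolutely_continuous_def
  proof
    fix X assume "X \<in> null_sets L"
    then have X: "X \<in> sets E" "emeasure M (Q j -` X \<inter> space M) = 0"
      using Q[OF j] by (auto simp: L_def null_sets_def emeasure_distr)
    then have "Q j -` X \<inter> space M \<in> null_sets M"
      using measurable_sets[OF Q[OF j]] by auto
    then have "(\<integral>\<^sup>+\<omega>. A j \<omega> * indicator (Q j -` X \<inter> space M) \<omega> \<partial>M) = 0"
      by (rule nn_integral_null_set)
    then have "emeasure N X = 0"
      unfolding N_def using X Qj A[OF j] measurable_sets[OF Q[OF j]]
      by (subst emeasure_distr) (auto simp: emeasure_density)
    then show "X \<in> null_sets N"
      using X by (simp add: N_def null_sets_def)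
  qed
  moreover have "sets N = sets L"
    by (simp add: N_def L_def)
  ultimately obtain \<Phi> where \<Phi>L: "\<Phi> \<in> borel_measurable L" and dens: "density L \<Phi> = N"
    using L.Radon_Nikodym by blast
  have \<Phi>: "\<Phi> \<in> borel_measurable E"
    using \<Phi>L by (simp add: L_def)
  have key_j: "(\<integral>\<^sup>+\<omega>. Z (Q j \<omega>) * A j \<omega> \<partial>M) = (\<integral>\<^sup>+x. Z x * \<Phi> x \<partial>L)" if Z: "Z \<in> borel_measurable E" for Z
  proof -
    have "(\<integral>\<^sup>+x. Z x * \<Phi> x \<partial>L) = (\<integral>\<^sup>+x. Z x \<partial>N)"
      using \<Phi>L Z by (subst dens[symmetric]) (simp add: nn_integral_density mult.commute sets_L cong: measurable_cong_sets)
    also have "\<dots> = (\<integral>\<^sup>+\<omega>. Z (Q j \<omega>) \<partial>density M (A j))"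
      unfolding N_def by (rule nn_integral_distr[OF Qj]) (use Z in simp)
    also have "\<dots> = (\<integral>\<^sup>+\<omega>. Z (Q j \<omega>) * A j \<omega> \<partial>M)"
      using measurable_compose[OF Q[OF j] Z] A[OF j] by (simp add: nn_integral_density mult.commute)
    finally show ?thesis ..
  qed
  have key: "(\<integral>\<^sup>+\<omega>. Z (Q i \<omega>) * A i \<omega> \<partial>M) = (\<integral>\<^sup>+x. Z x * \<Phi> x \<partial>L)" if i: "i \<in> I" and Z: "Z \<in> borel_measurable E" for i Z
  proof -
    have *: "(\<integral>\<^sup>+\<omega>. Z (Q k \<omega>) * A k \<omega> \<partial>M) = (\<integral>\<^sup>+t. \<integral>\<^sup>+x. Z x * h t x \<partial>L \<partial>lborel)" if k: "k \<in> I" for k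
      unfolding Fub[OF k measurable_compose[OF Q[OF k] Z]]
      using expect[OF k, of "\<lambda>x. Z x * h _ x"] Z h by (intro nn_integral_cong) simp
    show ?thesis
      unfolding key_j[OF Z, symmetric] *[OF i] *[OF j] ..
  qed
  have "AE \<omega> in M. A i \<omega> = \<Phi> (Q i \<omega>)" if i: "i \<in> I" for i
  proof (rule AE_eq_if_square_nn_integrals_eq)
    have \<Phi>Q: "(\<lambda>\<omega>. \<Phi> (Q i \<omega>)) \<in> borel_measurable M" if "i \<in> I" for i
      by (rule measurable_compose[OF Q[OF that] \<Phi>])
    have self: "(\<integral>\<^sup>+\<omega>. A k \<omega> * A k \<omega> \<partial>M) = (\<integral>\<^sup>+\<omega>. A k \<omega> * \<Phi> (Q k \<omega>) \<partial>M)" if k: "k \<in> I" for k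
    proof -
      have "(\<integral>\<^sup>+\<omega>. A k \<omega> * A k \<omega> \<partial>M) = (\<integral>\<^sup>+t. \<integral>\<^sup>+\<omega>. h t (Q k \<omega>) * A k \<omega> \<partial>M \<partial>lborel)"
        unfolding Fub[OF k A[OF k]] by (simp only: mult.commute)
      also have "\<dots> = (\<integral>\<^sup>+t. \<integral>\<^sup>+\<omega>. h t (Q k \<omega>) * \<Phi> (Q k \<omega>) \<partial>M \<partial>lborel)"
        using key[OF k h] expect[OF k, of "\<lambda>x. h _ x * \<Phi> x"] h \<Phi> by simp
      also have "\<dots> = (\<integral>\<^sup>+\<omega>. \<Phi> (Q k \<omega>) * A k \<omega> \<partial>M)"
        unfolding Fub[OF k \<Phi>Q[OF k]] by (simp only: mult.commute)
      finally show ?thesis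
        by (simp only: mult.commute)
    qed
    have mixed: "(\<integral>\<^sup>+\<omega>. A k \<omega> * \<Phi> (Q k \<omega>) \<partial>M) = (\<integral>\<^sup>+x. \<Phi> x * \<Phi> x \<partial>L)" if k: "k \<in> I" for k
      using key[OF k \<Phi>] by (simp only: mult.commute)
    show "A i \<in> borel_measurable M" "(\<lambda>\<omega>. \<Phi> (Q i \<omega>)) \<in> borel_measurable M"
      using A \<Phi>Q i by auto
    show "(\<integral>\<^sup>+\<omega>. A i \<omega> * A i \<omega> \<partial>M) = (\<integral>\<^sup>+\<omega>. A i \<omega> * \<Phi> (Q i \<omega>) \<partial>M)"
      by (rule self[OF i])
    show "(\<integral>\<^sup>+\<omega>. \<Phi> (Q i \<omega>) * \<Phi> (Q i \<omega>) \<partial>M) = (\<integral>\<^sup>+\<omega>. A i \<omega> * \<Phi> (Q i \<omega>) \<partial>M)"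
      unfolding mixed[OF i] using expect[OF i, of "\<lambda>x. \<Phi> x * \<Phi> x"] \<Phi> by simp
    show "(\<integral>\<^sup>+\<omega>. A i \<omega> * \<Phi> (Q i \<omega>) \<partial>M) < \<infinity>"
      unfolding mixed[OF i] mixed[OF j, symmetric] self[OF j, symmetric]
      using sq by (simp add: A_def power2_eq_square)
  qed
  with \<Phi> show ?thesis
    unfolding A_def by (rule that)
qed

text \<open>
  The probability of finitely many rectangles factorizes, first between the two families and then
  within each, and rectangles generate the product sigma-algebra.
\<close>

lemma (in prob_space)
  fixes X :: "'i \<Rightarrow> 'a \<Rightarrow> 'b" and Y :: "'i \<Rightarrow> 'a \<Rightarrow> 'c"
  assumes X: "indep_vars (\<lambda>_. E) X I" and Y: "indep_vars (\<lambda>_. E') Y I"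
    and XY: "indep_elements M (\<Pi>\<^sub>M i\<in>I. E) (\<lambda>\<omega>. \<lambda>i\<in>I. X i \<omega>) (\<Pi>\<^sub>M i\<in>I. E') (\<lambda>\<omega>. \<lambda>i\<in>I. Y i \<omega>)"
  shows indep_vars_Pair: "indep_vars (\<lambda>_. E \<Otimes>\<^sub>M E') (\<lambda>i \<omega>. (X i \<omega>, Y i \<omega>)) I"
    and distr_Pair_indep: "\<And>i. i \<in> I \<Longrightarrow> distr M (E \<Otimes>\<^sub>M E') (\<lambda>\<omega>. (X i \<omega>, Y i \<omega>)) = distr M E (X i) \<Otimes>\<^sub>M distr M E' (Y i)"
proof -
  have Xm [measurable]: "X i \<in> measurable M E" and Ym [measurable]: "Y i \<in> measurable M E'" if "i \<in> I" for i
    using X Y that by (auto simp: indep_vars_def)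
  have factor: "prob (\<Inter>j\<in>J. (\<lambda>\<omega>. (X j \<omega>, Y j \<omega>)) -` (A j \<times> C j) \<inter> space M) =
      prob (\<Inter>j\<in>J. X j -` A j \<inter> space M) * prob (\<Inter>j\<in>J. Y j -` C j \<inter> space M)"
    if J: "finite J" "J \<noteq> {}" "J \<subseteq> I" and A: "\<And>j. j \<in> J \<Longrightarrow> A j \<in> sets E" and C: "\<And>j. j \<in> J \<Longrightarrow> C j \<in> sets E'" for J A C
  proof -
    let ?U = "{x \<in> space (\<Pi>\<^sub>M i\<in>I. E). \<forall>j\<in>J. x j \<in> A j}" and ?V = "{x \<in> space (\<Pi>\<^sub>M i\<in>I. E'). \<forall>j\<in>J. x j \<in> C j}"
    have U: "?U \<in> sets (\<Pi>\<^sub>M i\<in>I. E)"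
      using J A by (intro sets.sets_Collect_finite_All measurable_sets_Collect[OF measurable_component_singleton]) auto
    have V: "?V \<in> sets (\<Pi>\<^sub>M i\<in>I. E')"
      using J C by (intro sets.sets_Collect_finite_All measurable_sets_Collect[OF measurable_component_singleton]) auto
    have XU: "(\<Inter>j\<in>J. X j -` A j \<inter> space M) = (\<lambda>\<omega>. \<lambda>i\<in>I. X i \<omega>) -` ?U \<inter> space M"
      using J measurable_space[OF Xm] by (auto simp: space_PiM subset_eq)
    have YV: "(\<Inter>j\<in>J. Y j -` C j \<inter> space M) = (\<lambda>\<omega>. \<lambda>i\<in>I. Y i \<omega>) -` ?V \<inter> space M"
      using J measurable_space[OF Ym] by (auto simp: space_PiM subset_eq)
    have "(\<Inter>j\<in>J. (\<lambda>\<omega>. (X j \<omega>, Y j \<omega>)) -` (A j \<times> C j) \<inter> space M) =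
        (\<Inter>j\<in>J. X j -` A j \<inter> space M) \<inter> (\<Inter>j\<in>J. Y j -` C j \<inter> space M)"
      using J by auto
    also have "prob \<dots> = prob (\<Inter>j\<in>J. X j -` A j \<inter> space M) * prob (\<Inter>j\<in>J. Y j -` C j \<inter> space M)"
    proof (rule indep_setD)
      show "indep_set {(\<lambda>\<omega>. \<lambda>i\<in>I. X i \<omega>) -` A \<inter> space M |A. A \<in> sets (\<Pi>\<^sub>M i\<in>I. E)}
          {(\<lambda>\<omega>. \<lambda>i\<in>I. Y i \<omega>) -` A \<inter> space M |A. A \<in> sets (\<Pi>\<^sub>M i\<in>I. E')}"
        using XY by (simp add: indep_elements_def)
      show "(\<Inter>j\<in>J. X j -` A j \<inter> space M) \<in> {(\<lambda>\<omega>. \<lambda>i\<in>I. X i \<omega>) -` A \<inter> space M |A. A \<in> sets (\<Pi>\<^sub>M i\<in>I. E)}"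
        unfolding XU by (intro CollectI exI[of _ ?U] conjI refl U)
      show "(\<Inter>j\<in>J. Y j -` C j \<inter> space M) \<in> {(\<lambda>\<omega>. \<lambda>i\<in>I. Y i \<omega>) -` A \<inter> space M |A. A \<in> sets (\<Pi>\<^sub>M i\<in>I. E')}"
        unfolding YV by (intro CollectI exI[of _ ?V] conjI refl V)
    qed
    finally show ?thesis .
  qed
  have pair: "(\<lambda>\<omega>. (X i \<omega>, Y i \<omega>)) \<in> measurable M (E \<Otimes>\<^sub>M E')" if "i \<in> I" for i
    using that by measurable
  have single: "prob ((\<lambda>\<omega>. (X i \<omega>, Y i \<omega>)) -` (A \<times> C) \<inter> space M) = prob (X i -` A \<inter> space M) * prob (Y i -` C \<inter> space M)"
    if "i \<in> I" "A \<in> sets E" "C \<in> sets E'" for i A C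
    using factor[of "{i}" "\<lambda>_. A" "\<lambda>_. C"] that by simp
  show "distr M (E \<Otimes>\<^sub>M E') (\<lambda>\<omega>. (X i \<omega>, Y i \<omega>)) = distr M E (X i) \<Otimes>\<^sub>M distr M E' (Y i)" if i: "i \<in> I" for i
  proof (rule pair_measure_eqI[symmetric])
    show "sigma_finite_measure (distr M E (X i))" "sigma_finite_measure (distr M E' (Y i))"
      using i prob_space_distr[OF Xm] prob_space_distr[OF Ym]
      by (auto intro: prob_space_imp_sigma_finite)
    fix A C assume "A \<in> sets (distr M E (X i))" "C \<in> sets (distr M E' (Y i))"
    then show "emeasure (distr M E (X i)) A * emeasure (distr M E' (Y i)) C =
        emeasure (distr M (E \<Otimes>\<^sub>M E') (\<lambda>\<omega>. (X i \<omega>, Y i \<omega>))) (A \<times> C)"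
      using i Xm[OF i] Ym[OF i] pair[OF i] single[of i A C]
      by (simp add: emeasure_distr emeasure_eq_measure ennreal_mult)
  qed simp
  show "indep_vars (\<lambda>_. E \<Otimes>\<^sub>M E') (\<lambda>i \<omega>. (X i \<omega>, Y i \<omega>)) I"
    unfolding indep_vars_def2
  proof (intro conjI ballI pair)
    show "indep_sets (\<lambda>i. {(\<lambda>\<omega>. (X i \<omega>, Y i \<omega>)) -` A \<inter> space M |A. A \<in> sets (E \<Otimes>\<^sub>M E')}) I"
      unfolding indep_sets_finite_index_sets[of _ I]
    proof (intro allI impI)
      fix J assume J: "J \<subseteq> I" "J \<noteq> {}" "finite J"
      have "indep_vars (\<lambda>_. E \<Otimes>\<^sub>M E') (\<lambda>i \<omega>. (X i \<omega>, Y i \<omega>)) J"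
      proof (subst indep_vars_finite[where E="\<lambda>_. {a \<times> b |a b. a \<in> sets E \<and> b \<in> sets E'}"])
        show "\<forall>A\<in>J \<rightarrow> {a \<times> b |a b. a \<in> sets E \<and> b \<in> sets E'}.
            prob (\<Inter>j\<in>J. (\<lambda>\<omega>. (X j \<omega>, Y j \<omega>)) -` A j \<inter> space M) =
            (\<Prod>j\<in>J. prob ((\<lambda>\<omega>. (X j \<omega>, Y j \<omega>)) -` A j \<inter> space M))"
        proof
          fix A assume "A \<in> J \<rightarrow> {a \<times> b |a b. a \<in> sets E \<and> b \<in> sets E'}"
          then have "\<forall>j\<in>J. \<exists>a b. A j = a \<times> b \<and> a \<in> sets E \<and> b \<in> sets E'"
            by (auto simp: Pi_iff)
          then obtain a b where ab: "\<And>j. j \<in> J \<Longrightarrow> A j = a j \<times> b j \<and> a j \<in> sets E \<and> b j \<in> sets E'"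
            by metis
          have "prob (\<Inter>j\<in>J. (\<lambda>\<omega>. (X j \<omega>, Y j \<omega>)) -` A j \<inter> space M) =
              prob (\<Inter>j\<in>J. (\<lambda>\<omega>. (X j \<omega>, Y j \<omega>)) -` (a j \<times> b j) \<inter> space M)"
            using ab by (intro arg_cong[where f=prob] INF_cong) auto
          also have "\<dots> = prob (\<Inter>j\<in>J. X j -` a j \<inter> space M) * prob (\<Inter>j\<in>J. Y j -` b j \<inter> space M)"
            using J ab by (intro factor) auto
          also have "prob (\<Inter>j\<in>J. X j -` a j \<inter> space M) = (\<Prod>j\<in>J. prob (X j -` a j \<inter> space M))"
            using J ab by (intro indep_varsD[OF X]) auto
          also have "prob (\<Inter>j\<in>J. Y j -` b j \<inter> space M) = (\<Prod>j\<in>J. prob (Y j -` b j \<inter> space M))"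
            using J ab by (intro indep_varsD[OF Y]) auto
          also have "(\<Prod>j\<in>J. prob (X j -` a j \<inter> space M)) * (\<Prod>j\<in>J. prob (Y j -` b j \<inter> space M)) =
              (\<Prod>j\<in>J. prob ((\<lambda>\<omega>. (X j \<omega>, Y j \<omega>)) -` A j \<inter> space M))"
            unfolding prod.distrib[symmetric] using J ab single by (intro prod.cong) auto
          finally show "prob (\<Inter>j\<in>J. (\<lambda>\<omega>. (X j \<omega>, Y j \<omega>)) -` A j \<inter> space M) =
            (\<Prod>j\<in>J. prob ((\<lambda>\<omega>. (X j \<omega>, Y j \<omega>)) -` A j \<inter> space M))" .
        qed
        show "sets (E \<Otimes>\<^sub>M E') = sigma_sets (space (E \<Otimes>\<^sub>M E')) {a \<times> b |a b. a \<in> sets E \<and> b \<in> sets E'}"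
          by (simp add: sets_pair_measure space_pair_measure)
        show "Int_stable {a \<times> b |a b. a \<in> sets E \<and> b \<in> sets E'}"
          by (rule Int_stable_pair_measure_generator)
        show "space (E \<Otimes>\<^sub>M E') \<in> {a \<times> b |a b. a \<in> sets E \<and> b \<in> sets E'}"
          by (auto simp: space_pair_measure)
        show "{a \<times> b |a b. a \<in> sets E \<and> b \<in> sets E'} \<subseteq> Pow (space (E \<Otimes>\<^sub>M E'))"
          by (auto simp: space_pair_measure dest: sets.sets_into_space)
      qed (use J pair in auto)
      then show "indep_sets (\<lambda>i. {(\<lambda>\<omega>. (X i \<omega>, Y i \<omega>)) -` A \<inter> space M |A. A \<in> sets (E \<Otimes>\<^sub>M E')}) J"
        by (simp add: indep_vars_def2)
    qed
  qed
qed

text \<open>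
  Extending the process constantly to negative times makes it jointly measurable on all of \<open>borel\<close>,
  which dispenses with the restricted space in what follows.
\<close>

lemma measurable_process_jointly_measurable:
  assumes "measurable_process M Y"
  shows "(\<lambda>(t, \<omega>). Y (max 0 t) \<omega>) \<in> borel_measurable (borel \<Otimes>\<^sub>M M)"
proof -
  have "(\<lambda>(t, \<omega>). (max 0 t, \<omega>)) \<in> measurable (borel \<Otimes>\<^sub>M M) (restrict_space borel {0 :: real..} \<Otimes>\<^sub>M M)"
    unfolding case_prod_beta' by (intro measurable_Pair measurable_restrict_space2) auto
  from measurable_compose[OF this assms[unfolded measurable_process_def]]
  show ?thesis
    by (simp add: case_prod_beta')
qed

text \<open>
  The instance for one cycle: the random element is the pair of waiting time and sample path, and
  the integrand at time \<open>t\<close> vanishes beyond the waiting time.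
\<close>

lemma (in prob_space) cycle_integral_eq_functional:
  fixes S :: "nat \<Rightarrow> 'a \<Rightarrow> real" and B :: "nat \<Rightarrow> real \<Rightarrow> 'a \<Rightarrow> real" and g :: "real \<Rightarrow> ennreal"
  assumes S: "\<And>n. 1 \<le> n \<Longrightarrow> S n \<in> borel_measurable M"
    and path: "\<And>n. 1 \<le> n \<Longrightarrow> sample_path (B n) \<in> measurable M path_space"
    and law: "\<And>n. 1 \<le> n \<Longrightarrow> distr M (borel \<Otimes>\<^sub>M path_space) (\<lambda>\<omega>. (S n \<omega>, sample_path (B n) \<omega>)) =
        distr M (borel \<Otimes>\<^sub>M path_space) (\<lambda>\<omega>. (S 1 \<omega>, sample_path (B 1) \<omega>))"
    and B: "\<And>n. 1 \<le> n \<Longrightarrow> measurable_process M (B n)"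
    and g: "g \<in> borel_measurable borel"
    and sq: "(\<integral>\<^sup>+\<omega>. (\<integral>\<^sup>+\<tau>\<in>{0..S 1 \<omega>}. g (B 1 \<tau> \<omega>) \<partial>lborel)\<^sup>2 \<partial>M) < \<infinity>"
  obtains \<Phi> where "\<Phi> \<in> borel_measurable (borel \<Otimes>\<^sub>M path_space)"
    and "\<And>n. 1 \<le> n \<Longrightarrow> AE \<omega> in M. (\<integral>\<^sup>+\<tau>\<in>{0..S n \<omega>}. g (B n \<tau> \<omega>) \<partial>lborel) = \<Phi> (S n \<omega>, sample_path (B n) \<omega>)"
proof -
  let ?Q = "\<lambda>n \<omega>. (S n \<omega>, sample_path (B n) \<omega>)"
  define h where "h t q = (if 0 \<le> t \<and> t \<le> fst q then g (snd q t) else 0)" for t :: real and q :: "real \<times> (real \<Rightarrow> real)"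
  have h_path: "h \<tau> (?Q n \<omega>) = g (B n (max 0 \<tau>) \<omega>) * indicator {0..S n \<omega>} \<tau>" for \<tau> n \<omega>
    by (auto simp: h_def sample_path_def indicator_def max_def)
  have h_int: "(\<integral>\<^sup>+\<tau>. h \<tau> (?Q n \<omega>) \<partial>lborel) = (\<integral>\<^sup>+\<tau>\<in>{0..S n \<omega>}. g (B n \<tau> \<omega>) \<partial>lborel)" for n \<omega>
    unfolding h_path by (intro nn_integral_cong) (auto simp: indicator_def max_def)
  have h_meas: "h t \<in> borel_measurable (borel \<Otimes>\<^sub>M path_space)" for t
  proof (cases "0 \<le> t")
    case True
    have "(\<lambda>b. b t) \<in> borel_measurable path_space"
      unfolding path_space_def using True by (intro measurable_component_singleton) auto
    from measurable_compose[OF measurable_compose[OF measurable_snd this] g]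
    have "(\<lambda>q. g (snd q t)) \<in> borel_measurable ((borel :: real measure) \<Otimes>\<^sub>M path_space)" .
    then show ?thesis
      unfolding h_def using True by (intro measurable_If) auto
  next
    case False
    then have "h t = (\<lambda>_. 0)"
      by (simp add: h_def fun_eq_iff)
    then show ?thesis by simp
  qed
  have joint: "(\<lambda>(t, \<omega>). h t (?Q n \<omega>)) \<in> borel_measurable (lborel \<Otimes>\<^sub>M M)" if n: "1 \<le> n" for n
  proof -
    have "(\<lambda>x. g (B n (max 0 (fst x)) (snd x))) \<in> borel_measurable (borel \<Otimes>\<^sub>M M)"
      using measurable_compose[OF measurable_process_jointly_measurable[OF B[OF n]] g] by (simp add: case_prod_beta')
    moreover have "Measurable.pred (borel \<Otimes>\<^sub>M M) (\<lambda>x. 0 \<le> fst x \<and> fst x \<le> S n (snd x))"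
      using measurable_compose[OF measurable_snd S[OF n]] by measurable
    ultimately have "(\<lambda>x. if 0 \<le> fst x \<and> fst x \<le> S n (snd x) then g (B n (max 0 (fst x)) (snd x)) else 0) \<in> borel_measurable (borel \<Otimes>\<^sub>M M)"
      by (intro measurable_If) auto
    also have "(\<lambda>x. if 0 \<le> fst x \<and> fst x \<le> S n (snd x) then g (B n (max 0 (fst x)) (snd x)) else 0) = (\<lambda>(t, \<omega>). h t (?Q n \<omega>))"
      by (auto simp: h_def sample_path_def fun_eq_iff max_def)
    finally show ?thesis
      by (simp cong: measurable_cong_sets)
  qed
  have Q_rv: "?Q n \<in> measurable M (borel \<Otimes>\<^sub>M path_space)" if "n \<in> {1..}" for n
    using S path that by (intro measurable_Pair) auto
  have Q_law: "distr M (borel \<Otimes>\<^sub>M path_space) (?Q n) = distr M (borel \<Otimes>\<^sub>M path_space) (?Q 1)" if "n \<in> {1..}" for n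
    using that by (intro law) simp
  have Q_joint: "(\<lambda>(t, \<omega>). h t (?Q n \<omega>)) \<in> borel_measurable (lborel \<Otimes>\<^sub>M M)" if "n \<in> {1..}" for n
    using that by (intro joint) simp
  have Q_sq: "(\<integral>\<^sup>+\<omega>. (\<integral>\<^sup>+t. h t (?Q 1 \<omega>) \<partial>lborel)\<^sup>2 \<partial>M) < \<infinity>"
    unfolding h_int by (rule sq)
  obtain \<Phi> where "\<Phi> \<in> borel_measurable (borel \<Otimes>\<^sub>M path_space)"
    and "\<And>n. n \<in> {1..} \<Longrightarrow> AE \<omega> in M. (\<integral>\<^sup>+t. h t (?Q n \<omega>) \<partial>lborel) = \<Phi> (?Q n \<omega>)"
    using time_integral_eq_functional[where Q="?Q" and I="{1..}" and j=1 and h=h and E="borel \<Otimes>\<^sub>M path_space",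
        OF Q_rv Q_law atLeast_iff[THEN iffD2, OF order_refl] h_meas Q_joint Q_sq] by auto
  then show ?thesis
    by (intro that[of \<Phi>]) (auto simp: h_int)
qed

section \<open>Decomposition of the additive functional along cycles\<close>

lemma measurable_cycle_reward:
  assumes S: "S n \<in> borel_measurable M" and B: "measurable_process M (B n)" and f: "f \<in> borel_measurable borel"
  shows "cycle_reward f S B n \<in> borel_measurable M"
proof -
  have "(\<lambda>x. f (B n (max 0 (fst x)) (snd x))) \<in> borel_measurable (borel \<Otimes>\<^sub>M M)"
    using measurable_compose[OF measurable_process_jointly_measurable[OF B] f] by (simp add: case_prod_beta')
  moreover have "Measurable.pred (borel \<Otimes>\<^sub>M M) (\<lambda>x. 0 \<le> fst x \<and> fst x \<le> S n (snd x))"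
    using measurable_compose[OF measurable_snd S] by measurable
  ultimately have "(\<lambda>x. if 0 \<le> fst x \<and> fst x \<le> S n (snd x) then f (B n (max 0 (fst x)) (snd x)) else 0) \<in> borel_measurable (borel \<Otimes>\<^sub>M M)"
    by (intro measurable_If) auto
  also have "(\<lambda>x. if 0 \<le> fst x \<and> fst x \<le> S n (snd x) then f (B n (max 0 (fst x)) (snd x)) else 0) =
      (\<lambda>(\<tau>, \<omega>). indicator {0..S n \<omega>} \<tau> *\<^sub>R f (B n \<tau> \<omega>))"
    by (auto simp: fun_eq_iff max_def indicator_def)
  finally have "(\<lambda>(\<tau>, \<omega>). indicator {0..S n \<omega>} \<tau> *\<^sub>R f (B n \<tau> \<omega>)) \<in> borel_measurable (lborel \<Otimes>\<^sub>M M)"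
    by (simp cong: measurable_cong_sets)
  from measurable_pair_swap[OF this]
  show ?thesis
    unfolding cycle_reward_def set_lebesgue_integral_def
    by (intro lborel.borel_measurable_lebesgue_integral) (simp add: case_prod_beta')
qed

text \<open>
  The set \<open>P\<close> is fixed up to its end points only: completed cycles occupy half-open intervals, since
  the process has already restarted at the reset time, while the running cycle is observed over
  a closed interval.
\<close>

lemma has_bochner_integral_shifted_piece:
  fixes g \<phi> :: "real \<Rightarrow> real"
  assumes g: "has_bochner_integral lborel (\<lambda>x. indicator {0..u} x * g x) I"
    and P: "{a<..<a + u} \<subseteq> P" "P \<subseteq> {a..a + u}" "P \<in> sets borel"
    and \<phi>: "\<And>x. x \<in> P \<Longrightarrow> \<phi> x = g (x - a)"
  shows "has_bochner_integral lborel (\<lambda>x. indicator P x * \<phi> x) I"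
proof -
  let ?\<psi> = "\<lambda>x. indicator {0..u} (x - a) * g (x - a)"
  have \<psi>: "has_bochner_integral lborel ?\<psi> I"
    using lborel_has_bochner_integral_real_affine_iff[of 1 "\<lambda>x. indicator {0..u} x * g x" I "- a"] g
    by (simp add: algebra_simps)
  have eq: "(\<lambda>x. indicator P x * \<phi> x) = (\<lambda>x. indicator P x * ?\<psi> x)"
    using P(2) \<phi> by (intro ext) (auto simp: indicator_def)
  have meas: "(\<lambda>x. indicator P x * ?\<psi> x) \<in> borel_measurable lborel"
    by (rule borel_measurable_times[OF borel_measurable_indicator borel_measurable_has_bochner_integral[OF \<psi>]])
      (use P(3) in simp)
  have ae: "AE x in lborel. ?\<psi> x = indicator P x * ?\<psi> x"
    using AE_lborel_singleton[of a] AE_lborel_singleton[of "a + u"]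
  proof eventually_elim
    case (elim x)
    have "x \<in> P" if "x - a \<in> {0..u}"
      using that elim by (intro subsetD[OF P(1)]) auto
    then show ?case
      by (auto simp: indicator_def)
  qed
  show ?thesis
    unfolding eq
    using has_bochner_integral_cong_AE[OF borel_measurable_has_bochner_integral[OF \<psi>] meas ae] \<psi> by (rule iffD1)
qed

lemma additive_functional_cycle_decomposition:
  assumes nonneg: "\<And>n. 1 \<le> n \<Longrightarrow> 0 \<le> S n \<omega>"
    and fin: "finite {n. reset_time S n \<omega> \<le> t}" and t: "0 \<le> t"
    and int: "\<And>n. 1 \<le> n \<Longrightarrow> set_integrable lborel {0..S n \<omega>} (\<lambda>\<tau>. f (B n \<tau> \<omega>))"
  shows "additive_functional f S B t \<omega> = (\<Sum>n=1..num_resets S t \<omega>. cycle_reward f S B n \<omega>) +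
    (LINT \<tau>:{0..t - reset_time S (num_resets S t \<omega>) \<omega>}|lborel. f (B (num_resets S t \<omega> + 1) \<tau> \<omega>))"
proof -
  let ?T = "\<lambda>n. reset_time S n \<omega>" and ?Z = "\<lambda>\<tau>. f (reset_process S B \<tau> \<omega>)" and ?N = "num_resets S t \<omega>"
  have mono: "?T m \<le> ?T n" if "m \<le> n" for m n
    by (rule reset_time_mono[where S=S and \<omega>=\<omega>, OF nonneg that])
  have Z: "?Z \<tau> = f (B (Suc n) (\<tau> - ?T n) \<omega>)" if "?T n \<le> \<tau>" "\<tau> < ?T (Suc n)" for n \<tau>
  proof -
    have "num_resets S \<tau> \<omega> = n"
      by (rule num_resets_eqI[where S=S and \<omega>=\<omega>, OF nonneg that])
    then show ?thesis
      by (simp add: reset_process_def)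
  qed
  have completed: "has_bochner_integral lborel (\<lambda>\<tau>. indicator {0..<?T n} \<tau> * ?Z \<tau>) (\<Sum>k=1..n. cycle_reward f S B k \<omega>)" for n
  proof (induction n)
    case 0
    then show ?case by (simp add: has_bochner_integral_zero)
  next
    case (Suc n)
    have "has_bochner_integral lborel (\<lambda>\<tau>. indicator {0..S (Suc n) \<omega>} \<tau> * f (B (Suc n) \<tau> \<omega>)) (cycle_reward f S B (Suc n) \<omega>)"
      using int[of "Suc n"] unfolding cycle_reward_def set_integrable_def set_lebesgue_integral_def
      by (simp add: has_bochner_integral_integrable)
    then have "has_bochner_integral lborel (\<lambda>\<tau>. indicator {?T n..<?T (Suc n)} \<tau> * ?Z \<tau>) (cycle_reward f S B (Suc n) \<omega>)"
      by (rule has_bochner_integral_shifted_piece[where a="?T n"]) (auto simp: reset_time_Suc intro!: Z)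
    note sum = has_bochner_integral_add[OF Suc this]
    have "indicator {0..<?T n} \<tau> * z + indicator {?T n..<?T (Suc n)} \<tau> * z = indicator {0..<?T (Suc n)} \<tau> * z" for \<tau> z :: real
      using mono[of n "Suc n"] mono[of 0 n] by (auto simp: indicator_def)
    then show ?case
      using sum by simp
  qed
  note N = num_resets_bounds[where S=S and \<omega>=\<omega>, OF nonneg fin t]
  let ?J = "LINT \<tau>:{0..t - ?T ?N}|lborel. f (B (?N + 1) \<tau> \<omega>)"
  have "set_integrable lborel {0..t - ?T ?N} (\<lambda>\<tau>. f (B (?N + 1) \<tau> \<omega>))"
    using N by (intro set_integrable_subset[OF int]) (auto simp: reset_time_Suc)
  then have "has_bochner_integral lborel (\<lambda>\<tau>. indicator {0..t - ?T ?N} \<tau> * f (B (Suc ?N) \<tau> \<omega>)) ?J"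
    unfolding set_integrable_def set_lebesgue_integral_def by (simp add: has_bochner_integral_integrable)
  then have "has_bochner_integral lborel (\<lambda>\<tau>. indicator {?T ?N..t} \<tau> * ?Z \<tau>) ?J"
  proof (rule has_bochner_integral_shifted_piece[where a="?T ?N"])
    show "?Z \<tau> = f (B (Suc ?N) (\<tau> - ?T ?N) \<omega>)" if "\<tau> \<in> {?T ?N..t}" for \<tau>
      using that N(2) by (intro Z) auto
  qed auto
  from has_bochner_integral_add[OF completed[of ?N] this]
  have "has_bochner_integral lborel (\<lambda>\<tau>. indicator {0..<?T ?N} \<tau> * ?Z \<tau> + indicator {?T ?N..t} \<tau> * ?Z \<tau>)
      ((\<Sum>n=1..?N. cycle_reward f S B n \<omega>) + ?J)" .
  moreover have "indicator {0..<?T ?N} \<tau> * z + indicator {?T ?N..t} \<tau> * z = indicator {0..t} \<tau> *\<^sub>R z" for \<tau> z :: real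
    using N(1) mono[of 0 ?N] by (auto simp: indicator_def)
  ultimately have "has_bochner_integral lborel (\<lambda>\<tau>. indicator {0..t} \<tau> *\<^sub>R ?Z \<tau>) ((\<Sum>n=1..?N. cycle_reward f S B n \<omega>) + ?J)"
    by (simp only:)
  then show ?thesis
    unfolding additive_functional_def set_lebesgue_integral_def
    by (rule has_bochner_integral_integral_eq)
qed

text \<open>
  The second part expresses the Bochner integral by the integrals of the positive and the negative
  part, to which the representation of nonnegative integrals applies. The third part, with \<open>u\<close> the age
  of the running cycle, bounds the contribution of that cycle by a quantity of the full cycle.
\<close>

lemma cycle_abs_reward_finite:
  assumes meas: "(\<lambda>\<tau>. f (B n (max 0 \<tau>) \<omega>)) \<in> borel_measurable borel"
    and fin: "cycle_abs_reward f S B n \<omega> < \<infinity>"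
  shows "set_integrable lborel {0..S n \<omega>} (\<lambda>\<tau>. f (B n \<tau> \<omega>))"
    and "cycle_reward f S B n \<omega> = enn2real (\<integral>\<^sup>+\<tau>\<in>{0..S n \<omega>}. ennreal (f (B n \<tau> \<omega>)) \<partial>lborel) -
      enn2real (\<integral>\<^sup>+\<tau>\<in>{0..S n \<omega>}. ennreal (- f (B n \<tau> \<omega>)) \<partial>lborel)"
    and "u \<le> S n \<omega> \<Longrightarrow> \<bar>LINT \<tau>:{0..u}|lborel. f (B n \<tau> \<omega>)\<bar> \<le> enn2real (cycle_abs_reward f S B n \<omega>)"
proof -
  have "(\<lambda>\<tau>. indicator {0..S n \<omega>} \<tau> *\<^sub>R f (B n (max 0 \<tau>) \<omega>)) \<in> borel_measurable lborel"
    using meas by simp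
  then have m: "(\<lambda>\<tau>. indicator {0..S n \<omega>} \<tau> *\<^sub>R f (B n \<tau> \<omega>)) \<in> borel_measurable lborel"
    by (rule measurable_cong[THEN iffD1, rotated]) (auto simp: indicator_def max_def)
  have norm: "(\<integral>\<^sup>+\<tau>. ennreal (norm (indicator {0..S n \<omega>} \<tau> *\<^sub>R f (B n \<tau> \<omega>))) \<partial>lborel) = cycle_abs_reward f S B n \<omega>"
    unfolding cycle_abs_reward_def by (intro nn_integral_cong) (auto simp: indicator_def)
  show int: "set_integrable lborel {0..S n \<omega>} (\<lambda>\<tau>. f (B n \<tau> \<omega>))"
    unfolding set_integrable_def using m fin norm by (intro integrableI_bounded) auto
  have "cycle_reward f S B n \<omega> = enn2real (\<integral>\<^sup>+\<tau>. ennreal (indicator {0..S n \<omega>} \<tau> *\<^sub>R f (B n \<tau> \<omega>)) \<partial>lborel) -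
      enn2real (\<integral>\<^sup>+\<tau>. ennreal (- (indicator {0..S n \<omega>} \<tau> *\<^sub>R f (B n \<tau> \<omega>))) \<partial>lborel)"
    unfolding cycle_reward_def set_lebesgue_integral_def
    using int by (intro real_lebesgue_integral_def) (simp add: set_integrable_def)
  also have "(\<integral>\<^sup>+\<tau>. ennreal (indicator {0..S n \<omega>} \<tau> *\<^sub>R f (B n \<tau> \<omega>)) \<partial>lborel) = (\<integral>\<^sup>+\<tau>\<in>{0..S n \<omega>}. ennreal (f (B n \<tau> \<omega>)) \<partial>lborel)"
    by (intro nn_integral_cong) (auto simp: indicator_def)
  also have "(\<integral>\<^sup>+\<tau>. ennreal (- (indicator {0..S n \<omega>} \<tau> *\<^sub>R f (B n \<tau> \<omega>))) \<partial>lborel) = (\<integral>\<^sup>+\<tau>\<in>{0..S n \<omega>}. ennreal (- f (B n \<tau> \<omega>)) \<partial>lborel)"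
    by (intro nn_integral_cong) (auto simp: indicator_def)
  finally show "cycle_reward f S B n \<omega> = enn2real (\<integral>\<^sup>+\<tau>\<in>{0..S n \<omega>}. ennreal (f (B n \<tau> \<omega>)) \<partial>lborel) -
      enn2real (\<integral>\<^sup>+\<tau>\<in>{0..S n \<omega>}. ennreal (- f (B n \<tau> \<omega>)) \<partial>lborel)" .
  assume u: "u \<le> S n \<omega>"
  have "\<bar>LINT \<tau>:{0..u}|lborel. f (B n \<tau> \<omega>)\<bar> \<le> (LINT \<tau>|lborel. norm (indicator {0..S n \<omega>} \<tau> *\<^sub>R f (B n \<tau> \<omega>)))"
    unfolding set_lebesgue_integral_def
  proof (rule integral_abs_bound_integral)
    show "integrable lborel (\<lambda>\<tau>. indicator {0..u} \<tau> *\<^sub>R f (B n \<tau> \<omega>))"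
      using set_integrable_subset[OF int, of "{0..u}"] u by (simp add: set_integrable_def)
    show "integrable lborel (\<lambda>\<tau>. norm (indicator {0..S n \<omega>} \<tau> *\<^sub>R f (B n \<tau> \<omega>)))"
      using int by (simp add: set_integrable_def)
    show "\<bar>indicator {0..u} \<tau> *\<^sub>R f (B n \<tau> \<omega>)\<bar> \<le> norm (indicator {0..S n \<omega>} \<tau> *\<^sub>R f (B n \<tau> \<omega>))" for \<tau>
      using u by (auto simp: indicator_def)
  qed
  also have "\<dots> = enn2real (cycle_abs_reward f S B n \<omega>)"
    unfolding norm[symmetric] using m by (intro integral_eq_nn_integral) auto
  finally show "\<bar>LINT \<tau>:{0..u}|lborel. f (B n \<tau> \<omega>)\<bar> \<le> enn2real (cycle_abs_reward f S B n \<omega>)" .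
qed

text \<open>
  On each event with a given number of resets the process is a jointly measurable process evaluated
  at a shifted time; countably many such events cover everything.
\<close>

lemma measurable_additive_functional:
  assumes nonneg: "\<And>n \<omega>. 1 \<le> n \<Longrightarrow> \<omega> \<in> space M \<Longrightarrow> 0 \<le> S n \<omega>"
    and S: "\<And>n. 1 \<le> n \<Longrightarrow> S n \<in> borel_measurable M"
    and B: "\<And>n. 1 \<le> n \<Longrightarrow> measurable_process M (B n)"
    and f: "f \<in> borel_measurable borel"
  shows "additive_functional f S B t \<in> borel_measurable M"
proof -
  define Bp where "Bp n \<tau> \<omega> = B n (max 0 \<tau>) \<omega>" for n \<tau> \<omega>
  have Bp: "(\<lambda>(\<tau>, \<omega>). Bp n \<tau> \<omega>) \<in> borel_measurable (borel \<Otimes>\<^sub>M M)" if "1 \<le> n" for n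
    unfolding Bp_def by (rule measurable_process_jointly_measurable[OF B[OF that]])
  have T: "reset_time S n \<in> borel_measurable M" for n
    unfolding reset_time_def using S by (intro borel_measurable_sum) auto
  let ?Zp = "\<lambda>(\<tau>, \<omega>). f (Bp (num_resets S \<tau> \<omega> + 1) (\<tau> - reset_time S (num_resets S \<tau> \<omega>) \<omega>) \<omega>)"
  have "?Zp \<in> borel_measurable (borel \<Otimes>\<^sub>M M)"
    unfolding case_prod_beta'
  proof (rule measurable_compose_countable)
    show "(\<lambda>x. num_resets S (fst x) (snd x)) \<in> measurable (borel \<Otimes>\<^sub>M M) (count_space UNIV)"
      using measurable_num_resets[OF S] by (simp add: case_prod_beta')
    fix k
    have "(\<lambda>x. (fst x - reset_time S k (snd x), snd x)) \<in> measurable (borel \<Otimes>\<^sub>M M) (borel \<Otimes>\<^sub>M M)"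
      using T[of k] by measurable
    from measurable_compose[OF measurable_compose[OF this Bp[of "k + 1"]] f]
    show "(\<lambda>x. f (Bp (k + 1) (fst x - reset_time S k (snd x)) (snd x))) \<in> borel_measurable (borel \<Otimes>\<^sub>M M)"
      by simp
  qed
  then have "(\<lambda>x. indicator {0..t} (fst x) *\<^sub>R ?Zp x) \<in> borel_measurable (borel \<Otimes>\<^sub>M M)"
    by (intro borel_measurable_scaleR borel_measurable_indicator') auto
  moreover have "indicator {0..t} (fst x) *\<^sub>R ?Zp x = indicator {0..t} (fst x) *\<^sub>R f (reset_process S B (fst x) (snd x))"
    if x: "x \<in> space (borel \<Otimes>\<^sub>M M)" for x
  proof (cases "0 \<le> fst x")
    case True
    have nn: "0 \<le> S n (snd x)" if "1 \<le> n" for n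
      using nonneg[OF that] x by (auto simp: space_pair_measure)
    have "reset_time S (num_resets S (fst x) (snd x)) (snd x) \<le> fst x"
      using num_resets_bounds(1)[where S=S and \<omega>="snd x", OF nn _ True] reset_time_le_if_infinite[where S=S and \<omega>="snd x", OF nn] by blast
    then show ?thesis
      by (simp add: Bp_def reset_process_def case_prod_beta')
  qed (simp add: indicator_def)
  ultimately have "(\<lambda>x. indicator {0..t} (fst x) *\<^sub>R f (reset_process S B (fst x) (snd x))) \<in> borel_measurable (borel \<Otimes>\<^sub>M M)"
    by (subst (asm) measurable_cong) auto
  then have "(\<lambda>(\<tau>, \<omega>). indicator {0..t} \<tau> *\<^sub>R f (reset_process S B \<tau> \<omega>)) \<in> borel_measurable (lborel \<Otimes>\<^sub>M M)"
    by (simp add: case_prod_beta' cong: measurable_cong_sets)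
  from measurable_pair_swap[OF this]
  show ?thesis
    unfolding additive_functional_def set_lebesgue_integral_def
    by (intro lborel.borel_measurable_lebesgue_integral) (simp add: case_prod_beta')
qed

section \<open>The central limit theorem for the additive functional\<close>

theorem theorem3p2:
  fixes M :: "'a measure"
    and S :: "nat \<Rightarrow> 'a \<Rightarrow> real"
    and B :: "nat \<Rightarrow> real \<Rightarrow> 'a \<Rightarrow> real"
    and f :: "real \<Rightarrow> real"
    and \<mu> v z :: real
  assumes "prob_space M"
    and S_nonneg: "\<And>n \<omega>. n \<ge> 1 \<Longrightarrow> \<omega> \<in> space M \<Longrightarrow> 0 \<le> S n \<omega>"
    and S_iid: "iid M borel S"
    and S_nontriv: "measure M {\<omega> \<in> space M. S 1 \<omega> = 0} < 1"
    and B_meas: "\<And>n. n \<ge> 1 \<Longrightarrow> measurable_process M (B n)"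
    and B_iid: "iid M path_space (\<lambda>n. sample_path (B n))"
    and B_indep_S: "indep_elements M
          (\<Pi>\<^sub>M n\<in>{1..}. borel) (\<lambda>\<omega>. \<lambda>n\<in>{1..}. S n \<omega>)
          (\<Pi>\<^sub>M n\<in>{1..}. path_space) (\<lambda>\<omega>. \<lambda>n\<in>{1..}. sample_path (B n) \<omega>)"
    and f_meas: "f \<in> borel_measurable borel"
    and S_sq: "integrable M (\<lambda>\<omega>. (S 1 \<omega>)\<^sup>2)"
    and M_sq: "(\<integral>\<^sup>+\<omega>. (cycle_abs_reward f S B 1 \<omega>)\<^sup>2 \<partial>M) < \<infinity>"
    and mu: "\<mu> = (LINT \<omega>|M. cycle_reward f S B 1 \<omega>) / (LINT \<omega>|M. S 1 \<omega>)"
    and v: "v = (LINT \<omega>|M. (cycle_reward f S B 1 \<omega> - \<mu> * S 1 \<omega>)\<^sup>2) / (LINT \<omega>|M. S 1 \<omega>)"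
    and v_nonzero: "v \<noteq> 0"
  shows "((\<lambda>t. measure M {\<omega> \<in> space M.
              (additive_functional f S B t \<omega> - \<mu> * t) / sqrt (v * t) \<le> z})
          \<longlongrightarrow> (LINT x:{..z}|lborel. exp (- (1 / 2) * x\<^sup>2) / sqrt (2 * pi))) at_top"
proof -
  interpret prob_space M by fact
  let ?E = "(borel :: real measure) \<Otimes>\<^sub>M path_space"
  define Q where "Q n \<omega> = (S n \<omega>, sample_path (B n) \<omega>)" for n \<omega>
  have S_ind: "indep_vars (\<lambda>_. borel) S {1..}" and S_law: "\<And>n. 1 \<le> n \<Longrightarrow> distr M borel (S n) = distr M borel (S 1)"
    using S_iid unfolding iid_def by blast+
  have B_ind: "indep_vars (\<lambda>_. path_space) (\<lambda>n. sample_path (B n)) {1..}"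
    and B_law: "\<And>n. 1 \<le> n \<Longrightarrow> distr M path_space (sample_path (B n)) = distr M path_space (sample_path (B 1))"
    using B_iid unfolding iid_def by blast+
  have S_rv: "S n \<in> borel_measurable M" if "1 \<le> n" for n
    using S_ind that by (auto simp: indep_vars_def)
  have B_rv: "sample_path (B n) \<in> measurable M path_space" if "1 \<le> n" for n
    using B_ind that by (auto simp: indep_vars_def)
  have Q_ind: "indep_vars (\<lambda>_. ?E) Q {1..}"
    unfolding Q_def by (rule indep_vars_Pair[OF S_ind B_ind B_indep_S])
  have Q_law: "distr M ?E (Q n) = distr M ?E (Q 1)" if n: "1 \<le> n" for n
    unfolding Q_def distr_Pair_indep[OF S_ind B_ind B_indep_S atLeast_iff[THEN iffD2, OF n]]
      distr_Pair_indep[OF S_ind B_ind B_indep_S atLeast_iff[THEN iffD2, OF order_refl]] S_law[OF n] B_law[OF n] ..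
  have Q_rv: "Q n \<in> measurable M ?E" if "1 \<le> n" for n
    using Q_ind that by (auto simp: indep_vars_def)
  define e where "e = expectation (S 1)"
  have S_int: "integrable M (S 1)"
    by (rule square_integrable_imp_integrable[OF S_rv S_sq]) simp
  have e_pos: "0 < e"
  proof (rule ccontr)
    assume "\<not> 0 < e"
    moreover have "0 \<le> e"
      unfolding e_def using S_nonneg by (intro integral_nonneg_AE) auto
    ultimately have "expectation (S 1) = 0"
      by (simp add: e_def)
    moreover have "AE \<omega> in M. 0 \<le> S 1 \<omega>"
      using S_nonneg by auto
    ultimately have "AE \<omega> in M. S 1 \<omega> = 0"
      using integral_nonneg_eq_0_iff_AE[OF S_int] by blast
    then have "prob {\<omega> \<in> space M. S 1 \<omega> = 0} = 1"
      using S_rv[of 1] by (subst prob_Collect_eq_1) auto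
    with S_nontriv show False by simp
  qed

  \<comment> \<open>The integrals of \<open>\<bar>f\<bar>\<close> and of the positive and negative parts of \<open>f\<close> over a cycle are functionals of
    \<open>Q n\<close>, all square-integrable since \<open>\<bar>f\<bar>\<close> dominates. Thus the \<open>\<psi> (Q n)\<close> are independent and
    identically distributed, and almost surely equal to \<open>cycle_reward f S B n \<omega> - \<mu> * S n \<omega>\<close>.\<close>
  have dominated: "(\<integral>\<^sup>+\<omega>. (\<integral>\<^sup>+\<tau>\<in>{0..S 1 \<omega>}. g (B 1 \<tau> \<omega>) \<partial>lborel)\<^sup>2 \<partial>M) < \<infinity>"
    if "\<And>x. g x \<le> ennreal \<bar>f x\<bar>" for g
  proof -
    have "(\<integral>\<^sup>+\<omega>. (\<integral>\<^sup>+\<tau>\<in>{0..S 1 \<omega>}. g (B 1 \<tau> \<omega>) \<partial>lborel)\<^sup>2 \<partial>M) \<le> (\<integral>\<^sup>+\<omega>. (cycle_abs_reward f S B 1 \<omega>)\<^sup>2 \<partial>M)"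
      unfolding cycle_abs_reward_def using that by (intro nn_integral_mono power_mono mult_right_mono) auto
    with M_sq show ?thesis by (rule le_less_trans[rotated])
  qed
  have functional: "\<exists>\<Phi>. \<Phi> \<in> borel_measurable ?E \<and>
      (\<forall>n\<ge>1. AE \<omega> in M. (\<integral>\<^sup>+\<tau>\<in>{0..S n \<omega>}. g (B n \<tau> \<omega>) \<partial>lborel) = \<Phi> (Q n \<omega>))"
    if "g \<in> borel_measurable borel" "\<And>x. g x \<le> ennreal \<bar>f x\<bar>" for g
  proof (rule cycle_integral_eq_functional[where S=S and B=B and g=g,
        OF S_rv B_rv Q_law[unfolded Q_def] B_meas that(1) dominated[OF that(2)]])
    fix \<Phi> assume "\<Phi> \<in> borel_measurable ?E"
      and "\<And>n. 1 \<le> n \<Longrightarrow> AE \<omega> in M. (\<integral>\<^sup>+\<tau>\<in>{0..S n \<omega>}. g (B n \<tau> \<omega>) \<partial>lborel) = \<Phi> (S n \<omega>, sample_path (B n) \<omega>)"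
    then show ?thesis
      unfolding Q_def by (intro exI[of _ \<Phi>]) simp
  qed
  obtain \<Phi>a where \<Phi>a [measurable]: "\<Phi>a \<in> borel_measurable ?E"
    and a: "\<And>n. 1 \<le> n \<Longrightarrow> AE \<omega> in M. cycle_abs_reward f S B n \<omega> = \<Phi>a (Q n \<omega>)"
    using functional[of "\<lambda>x. ennreal \<bar>f x\<bar>"] f_meas unfolding cycle_abs_reward_def by auto
  obtain \<Phi>p where \<Phi>p [measurable]: "\<Phi>p \<in> borel_measurable ?E"
    and p: "\<And>n. 1 \<le> n \<Longrightarrow> AE \<omega> in M. (\<integral>\<^sup>+\<tau>\<in>{0..S n \<omega>}. ennreal (f (B n \<tau> \<omega>)) \<partial>lborel) = \<Phi>p (Q n \<omega>)"
    using functional[of "\<lambda>x. ennreal (f x)", OF _ ennreal_leI[OF abs_ge_self]] f_meas by auto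
  obtain \<Phi>m where \<Phi>m [measurable]: "\<Phi>m \<in> borel_measurable ?E"
    and m: "\<And>n. 1 \<le> n \<Longrightarrow> AE \<omega> in M. (\<integral>\<^sup>+\<tau>\<in>{0..S n \<omega>}. ennreal (- f (B n \<tau> \<omega>)) \<partial>lborel) = \<Phi>m (Q n \<omega>)"
    using functional[of "\<lambda>x. ennreal (- f x)", OF _ ennreal_leI[OF abs_ge_minus_self]] f_meas by auto
  define \<psi> where "\<psi> q = enn2real (\<Phi>p q) - enn2real (\<Phi>m q) - \<mu> * fst q" for q
  define w where "w q = enn2real (\<Phi>a q) + \<bar>\<mu>\<bar> * fst q" for q
  have \<psi>_meas: "\<psi> \<in> borel_measurable ?E" and w_meas: "w \<in> borel_measurable ?E"
    unfolding \<psi>_def w_def by measurable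
  have \<Phi>a_sq: "(\<integral>\<^sup>+\<omega>. (\<Phi>a (Q 1 \<omega>))\<^sup>2 \<partial>M) < \<infinity>"
  proof -
    have "(\<integral>\<^sup>+\<omega>. (\<Phi>a (Q 1 \<omega>))\<^sup>2 \<partial>M) = (\<integral>\<^sup>+\<omega>. (cycle_abs_reward f S B 1 \<omega>)\<^sup>2 \<partial>M)"
      using a[of 1] by (intro nn_integral_cong_AE) auto
    with M_sq show ?thesis by simp
  qed
  have \<Phi>aQ [measurable]: "(\<lambda>\<omega>. \<Phi>a (Q 1 \<omega>)) \<in> borel_measurable M"
    by (rule measurable_compose[OF Q_rv \<Phi>a]) simp
  have fin1: "AE \<omega> in M. \<Phi>a (Q 1 \<omega>) \<noteq> \<infinity>"
  proof -
    have "(\<lambda>\<omega>. (\<Phi>a (Q 1 \<omega>))\<^sup>2) \<in> borel_measurable M"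
      unfolding power2_eq_square by (intro borel_measurable_times_ennreal \<Phi>aQ)
    then have "AE \<omega> in M. (\<Phi>a (Q 1 \<omega>))\<^sup>2 \<noteq> \<infinity>"
      using \<Phi>a_sq by (intro nn_integral_noteq_infinite) (simp_all add: less_top)
    then show ?thesis
      by eventually_elim (auto simp: power2_eq_square ennreal_mult_eq_top_iff)
  qed
  have fin: "AE \<omega> in M. \<Phi>a (Q n \<omega>) \<noteq> \<infinity>" if n: "1 \<le> n" for n
  proof -
    have top: "{q \<in> space ?E. \<Phi>a q \<noteq> \<infinity>} \<in> sets ?E"
      by measurable
    have "AE q in distr M ?E (Q 1). \<Phi>a q \<noteq> \<infinity>"
      using fin1 AE_distr_iff[OF Q_rv[OF order_refl] top] by simp
    then have "AE q in distr M ?E (Q n). \<Phi>a q \<noteq> \<infinity>"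
      unfolding Q_law[OF n] .
    then show ?thesis
      using AE_distr_iff[OF Q_rv[OF n] top] by simp
  qed
  have path_meas: "(\<lambda>\<tau>. f (B n (max 0 \<tau>) \<omega>)) \<in> borel_measurable borel" if "1 \<le> n" "\<omega> \<in> space M" for n \<omega>
    using measurable_compose[OF measurable_compose[OF measurable_Pair2'[OF that(2)]
          measurable_process_jointly_measurable[OF B_meas[OF that(1)]]] f_meas] by simp
  have good_n: "AE \<omega> in M. cycle_abs_reward f S B n \<omega> < \<infinity> \<and> cycle_abs_reward f S B n \<omega> = \<Phi>a (Q n \<omega>) \<and>
      cycle_reward f S B n \<omega> - \<mu> * S n \<omega> = \<psi> (Q n \<omega>)" if n: "1 \<le> n" for n
    using a[OF n] p[OF n] m[OF n] fin[OF n] AE_space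
  proof eventually_elim
    case (elim \<omega>)
    then have *: "cycle_abs_reward f S B n \<omega> < \<infinity>"
      by (simp add: less_top)
    show ?case
      using * elim cycle_abs_reward_finite(2)[OF path_meas[OF n elim(5)] *] by (simp add: \<psi>_def Q_def)
  qed
  have "AE \<omega> in M. \<forall>n. 1 \<le> n \<longrightarrow> (cycle_abs_reward f S B n \<omega> < \<infinity> \<and> cycle_abs_reward f S B n \<omega> = \<Phi>a (Q n \<omega>) \<and>
      cycle_reward f S B n \<omega> - \<mu> * S n \<omega> = \<psi> (Q n \<omega>))"
    unfolding AE_all_countable using good_n by auto
  then have good: "AE \<omega> in M. \<forall>n\<ge>1. cycle_abs_reward f S B n \<omega> < \<infinity> \<and> cycle_abs_reward f S B n \<omega> = \<Phi>a (Q n \<omega>) \<and>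
      cycle_reward f S B n \<omega> - \<mu> * S n \<omega> = \<psi> (Q n \<omega>)"
    by simp

  \<comment> \<open>Cycles are numbered from 1 and the summands of the limit theorem from 0, so that \<open>W\<close> at the number
    of resets belongs to the running cycle.\<close>
  define Y where "Y i \<omega> = \<psi> (Q (Suc i) \<omega>)" for i \<omega>
  define W where "W i \<omega> = w (Q (Suc i) \<omega>)" for i \<omega>
  have Y_rv: "random_variable borel (Y i)" and W_rv: "random_variable borel (W i)" for i
    unfolding Y_def W_def using measurable_compose[OF Q_rv \<psi>_meas] measurable_compose[OF Q_rv w_meas] by auto
  have "indep_vars (\<lambda>_. ?E) (\<lambda>i. Q (Suc i)) UNIV"
    by (rule indep_vars_reindex, rule indep_vars_subset[OF Q_ind]) auto
  then have Y_ind: "indep_vars (\<lambda>_. borel) Y UNIV"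
    unfolding Y_def by (rule indep_vars_compose2[where Y="\<lambda>_. \<psi>"]) (rule \<psi>_meas)
  have Y_law: "distr M borel (Y i) = distr M borel (Y 0)" for i
    unfolding Y_def[abs_def] One_nat_def[symmetric]
    by (rule identically_distributed(3)[OF Q_rv Q_rv Q_law \<psi>_meas]) auto
  have W_law: "distr M borel (W i) = distr M borel (W 0)" for i
    unfolding W_def[abs_def] One_nat_def[symmetric]
    by (rule identically_distributed(3)[OF Q_rv Q_rv Q_law w_meas]) auto

  have W_sq: "integrable M (\<lambda>\<omega>. (W 0 \<omega>)\<^sup>2)"
  proof -
    have "integrable M (\<lambda>\<omega>. (enn2real (\<Phi>a (Q 1 \<omega>)))\<^sup>2)"
    proof (rule integrableI_bounded)
      have "(\<integral>\<^sup>+\<omega>. ennreal (norm ((enn2real (\<Phi>a (Q 1 \<omega>)))\<^sup>2)) \<partial>M) = (\<integral>\<^sup>+\<omega>. (\<Phi>a (Q 1 \<omega>))\<^sup>2 \<partial>M)"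
        using fin1 by (intro nn_integral_cong_AE, eventually_elim)
          (simp add: ennreal_power[symmetric] less_top)
      then show "(\<integral>\<^sup>+\<omega>. ennreal (norm ((enn2real (\<Phi>a (Q 1 \<omega>)))\<^sup>2)) \<partial>M) < \<infinity>"
        using \<Phi>a_sq by simp
    qed measurable
    then have "integrable M (\<lambda>\<omega>. 2 * (enn2real (\<Phi>a (Q 1 \<omega>)))\<^sup>2 + 2 * \<mu>\<^sup>2 * (S 1 \<omega>)\<^sup>2)"
      using S_sq by auto
    then show ?thesis
    proof (rule Bochner_Integration.integrable_bound)
      show "(\<lambda>\<omega>. (W 0 \<omega>)\<^sup>2) \<in> borel_measurable M"
        using W_rv by measurable
      have "(x + \<bar>\<mu>\<bar> * y)\<^sup>2 \<le> 2 * x\<^sup>2 + 2 * \<mu>\<^sup>2 * y\<^sup>2" for x y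
        using sum_squares_bound[of x "\<bar>\<mu>\<bar> * y"] by (simp add: power2_sum power_mult_distrib)
      then show "AE \<omega> in M. norm ((W 0 \<omega>)\<^sup>2) \<le> norm (2 * (enn2real (\<Phi>a (Q 1 \<omega>)))\<^sup>2 + 2 * \<mu>\<^sup>2 * (S 1 \<omega>)\<^sup>2)"
        by (simp add: W_def w_def Q_def)
    qed
  qed
  have X_rv: "cycle_reward f S B 1 \<in> borel_measurable M"
    by (rule measurable_cycle_reward[OF S_rv B_meas f_meas]) auto
  have Y0: "AE \<omega> in M. Y 0 \<omega> = cycle_reward f S B 1 \<omega> - \<mu> * S 1 \<omega>"
    using good_n[of 1] by (auto simp: Y_def)
  have X_le: "AE \<omega> in M. \<bar>cycle_reward f S B 1 \<omega>\<bar> + \<bar>\<mu>\<bar> * S 1 \<omega> \<le> W 0 \<omega>"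
    using good_n[of 1, OF order_refl] AE_space
  proof eventually_elim
    case (elim \<omega>)
    then have "\<bar>cycle_reward f S B 1 \<omega>\<bar> \<le> enn2real (cycle_abs_reward f S B 1 \<omega>)"
      unfolding cycle_reward_def by (intro cycle_abs_reward_finite(3) path_meas) auto
    with elim show ?case
      by (simp add: W_def w_def Q_def)
  qed
  have W_int: "integrable M (W 0)"
    by (rule square_integrable_imp_integrable[OF W_rv W_sq])
  have X_int: "integrable M (cycle_reward f S B 1)"
    using W_int X_rv
  proof (rule Bochner_Integration.integrable_bound)
    show "AE \<omega> in M. norm (cycle_reward f S B 1 \<omega>) \<le> norm (W 0 \<omega>)"
      using X_le AE_space
    proof eventually_elim
      case (elim \<omega>)
      then have "0 \<le> \<bar>\<mu>\<bar> * S 1 \<omega>"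
        using S_nonneg[of 1 \<omega>] by simp
      with elim show ?case
        unfolding real_norm_def by linarith
    qed
  qed
  have Y_sq: "integrable M (\<lambda>\<omega>. (Y 0 \<omega>)\<^sup>2)"
    using W_sq
  proof (rule Bochner_Integration.integrable_bound)
    show "(\<lambda>\<omega>. (Y 0 \<omega>)\<^sup>2) \<in> borel_measurable M"
      using Y_rv by measurable
    show "AE \<omega> in M. norm ((Y 0 \<omega>)\<^sup>2) \<le> norm ((W 0 \<omega>)\<^sup>2)"
      using X_le Y0 AE_space
    proof eventually_elim
      case (elim \<omega>)
      have "\<bar>\<mu> * S 1 \<omega>\<bar> = \<bar>\<mu>\<bar> * S 1 \<omega>"
        using S_nonneg[of 1 \<omega>] elim(3) by (simp add: abs_mult)
      then have "\<bar>Y 0 \<omega>\<bar> \<le> \<bar>W 0 \<omega>\<bar>"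
        using elim by linarith
      then show ?case
        by (simp add: abs_le_square_iff)
    qed
  qed
  have Y_mean: "expectation (Y 0) = 0"
  proof -
    have "expectation (Y 0) = expectation (\<lambda>\<omega>. cycle_reward f S B 1 \<omega> - \<mu> * S 1 \<omega>)"
      using Y0 Y_rv X_rv S_rv[of 1] by (intro integral_cong_AE) auto
    also have "\<dots> = 0"
      using X_int S_int e_pos by (simp add: mu e_def)
    finally show ?thesis .
  qed
  define s where "s = expectation (\<lambda>\<omega>. (Y 0 \<omega>)\<^sup>2)"
  have s_eq: "s = expectation (\<lambda>\<omega>. (cycle_reward f S B 1 \<omega> - \<mu> * S 1 \<omega>)\<^sup>2)"
    unfolding s_def using Y0 Y_rv[of 0] X_rv S_rv[of 1] by (intro integral_cong_AE) auto
  have v_eq: "v = 1 / e * s"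
    by (simp add: v s_eq e_def)
  have "0 \<le> s"
    unfolding s_def by simp
  then have s_pos: "0 < s"
    using v_nonzero by (cases "s = 0") (auto simp: v_eq)

  have finitely_many: "AE \<omega> in M. finite {n. reset_time S n \<omega> \<le> t}" for t
    by (rule AE_finitely_many_resets[OF S_nonneg S_ind S_law S_sq e_pos[unfolded e_def]])
  \<comment> \<open>Completed cycles contribute the sum of the \<open>Y i\<close>; what is left is the integral over the running
    cycle minus \<open>\<mu>\<close> times its age.\<close>
  have bound: "AE \<omega> in M. \<bar>(additive_functional f S B t \<omega> - \<mu> * t) - (\<Sum>i<num_resets S t \<omega>. Y i \<omega>)\<bar> \<le> W (num_resets S t \<omega>) \<omega>"
    if t: "0 < t" for t
    using good finitely_many[of t] AE_space
  proof eventually_elim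
    case (elim \<omega>)
    let ?N = "num_resets S t \<omega>"
    have nn: "0 \<le> S n \<omega>" if "1 \<le> n" for n
      using S_nonneg[OF that] elim by auto
    have abs_fin: "cycle_abs_reward f S B n \<omega> < \<infinity>" if "1 \<le> n" for n
      using elim(1) that by auto
    have int: "set_integrable lborel {0..S n \<omega>} (\<lambda>\<tau>. f (B n \<tau> \<omega>))" if "1 \<le> n" for n
      by (rule cycle_abs_reward_finite(1)[OF path_meas[OF that elim(3)] abs_fin[OF that]])
    define J where "J = (LINT \<tau>:{0..t - reset_time S ?N \<omega>}|lborel. f (B (?N + 1) \<tau> \<omega>))"
    have F: "additive_functional f S B t \<omega> = (\<Sum>n=1..?N. cycle_reward f S B n \<omega>) + J"
      unfolding J_def by (rule additive_functional_cycle_decomposition[where S=S and B=B and f=f and \<omega>=\<omega>, OF nn elim(2) less_imp_le[OF t] int])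
    note N = num_resets_bounds[where S=S and \<omega>=\<omega>, OF nn elim(2) less_imp_le[OF t]]
    have "(\<Sum>i<?N. Y i \<omega>) = (\<Sum>n=1..?N. \<psi> (Q n \<omega>))"
      by (simp add: Y_def sum.atLeast1_atMost_eq)
    also have "\<dots> = (\<Sum>n=1..?N. cycle_reward f S B n \<omega> - \<mu> * S n \<omega>)"
      using elim(1) by (intro sum.cong) auto
    also have "\<dots> = (\<Sum>n=1..?N. cycle_reward f S B n \<omega>) - \<mu> * reset_time S ?N \<omega>"
      by (simp add: sum_subtractf sum_distrib_left reset_time_def)
    finally have diff: "(additive_functional f S B t \<omega> - \<mu> * t) - (\<Sum>i<?N. Y i \<omega>) = J - \<mu> * (t - reset_time S ?N \<omega>)"
      by (simp add: F algebra_simps)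
    have "t - reset_time S ?N \<omega> \<le> S (?N + 1) \<omega>"
      using N by (simp add: reset_time_Suc)
    then have "\<bar>J\<bar> \<le> enn2real (cycle_abs_reward f S B (?N + 1) \<omega>)"
      unfolding J_def by (intro cycle_abs_reward_finite(3) path_meas elim(3) abs_fin) auto
    moreover have "\<bar>\<mu> * (t - reset_time S ?N \<omega>)\<bar> \<le> \<bar>\<mu>\<bar> * S (?N + 1) \<omega>"
      unfolding abs_mult using N by (intro mult_left_mono) (auto simp: reset_time_Suc)
    moreover have "W ?N \<omega> = enn2real (cycle_abs_reward f S B (?N + 1) \<omega>) + \<bar>\<mu>\<bar> * S (?N + 1) \<omega>"
      using elim(1) by (simp add: W_def w_def Q_def)
    ultimately show ?case
      unfolding diff by linarith
  qed

  have "((\<lambda>t. prob {\<omega> \<in> space M. (additive_functional f S B t \<omega> - \<mu> * t) / sqrt (1 / e * s * t) \<le> z})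
      \<longlongrightarrow> cdf std_normal_distribution z) at_top"
  proof (rule Anscombe_clt_with_remainder[where Y=Y and W=W and N="num_resets S" and s=s and c="1 / e"
        and F="\<lambda>t \<omega>. additive_functional f S B t \<omega> - \<mu> * t",
        OF Y_ind Y_law Y_sq Y_mean s_def[symmetric] s_pos W_rv W_law W_sq])
    show "num_resets S t \<in> measurable M (count_space UNIV)" for t
    proof -
      have "(\<lambda>\<omega>. (t, \<omega>)) \<in> measurable M (borel \<Otimes>\<^sub>M M)"
        by measurable
      from measurable_compose[OF this measurable_num_resets[OF S_rv]] show ?thesis
        by simp
    qed
    show "((\<lambda>t. prob {\<omega> \<in> space M. \<delta> * t \<le> \<bar>real (num_resets S t \<omega>) - 1 / e * t\<bar>}) \<longlongrightarrow> 0) at_top" if "0 < \<delta>" for \<delta>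
      unfolding e_def by (rule num_resets_weak_law[OF S_nonneg S_ind S_law S_sq e_pos[unfolded e_def] that])
    show "(\<lambda>\<omega>. additive_functional f S B t \<omega> - \<mu> * t) \<in> borel_measurable M" for t
      using measurable_additive_functional[where t=t, OF S_nonneg S_rv B_meas f_meas] by simp
  qed (use e_pos bound in auto)
  then show ?thesis
    unfolding cdf_std_normal_distribution v_eq .
qed

end
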